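(* Assume the Riemann hypothesis and Conjecture 1 (stated in the context). Then, as $T\to\infty$, $$\sup_{\alpha,\beta}\ \Bigg|\sum_{\substack{0<\gamma\le T\\ \{\gamma(\log T)/2\pi\}\in[\alpha,\beta]}}1\ -\ (\beta-\alpha)N(T)\Bigg|=o(N(T)),$$ where the supremum is over all subintervals $[\alpha,\beta]$ of $[0,1]$.
   Context: Under the Riemann hypothesis every nontrivial zero of the Riemann zeta function has the form $\frac12+i\gamma$ with $\gamma$ real; $\gamma$ always denotes such an ordinate, and sums over $\gamma$ count zeros with multiplicity. $N(T)$ is the number of ordinates $\gamma$ in $(0,T]$, counted with multiplicity. $\{x\}$ denotes the fractional part of $x$. Conjecture 1: for $x,T\ge2$ and any fixed $\epsilon>0$, $$\sum_{0<\gamma\le T}x^{i\gamma}\ll T x^{-\frac12+\epsilon}+T^{\frac12}x^{\epsilon},$$ where the implied constant depends only on $\epsilon$. *)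

theory Defs
  imports
    "HOL-Complex_Analysis.Complex_Analysis"
    "HOL-Library.Landau_Symbols"
begin

text \<open>
  The Riemann zeta function is the analytic continuation of the Dirichlet series
  to the plane punctured at 1. The continuation is unique by the identity theorem;
  the value at the pole \<open>s = 1\<close> is arbitrary and is never used below.
\<close>

definition zeta :: "complex \<Rightarrow> complex" where
  "zeta = (SOME f. f holomorphic_on (- {1}) \<and>
             (\<forall>s. Re s > 1 \<longrightarrow> (\<lambda>n. of_nat (Suc n) powr (- s)) sums f s))"

definition nontrivial_zeros :: "complex set" where
  "nontrivial_zeros =
     {s. s \<noteq> 1 \<and> zeta s = 0 \<and> (\<forall>n::nat. n \<ge> 1 \<longrightarrow> s \<noteq> - 2 * of_nat n)}"

definition riemann_hypothesis :: bool where
  "riemann_hypothesis \<longleftrightarrow> (\<forall>s \<in> nontrivial_zeros. Re s = 1 / 2)"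

text \<open>
  Under the Riemann hypothesis the set below contains the imaginary parts of all
  nontrivial zeros. It is a set, so multiplicities are supplied as weights in the sums.
\<close>

definition zeta_ordinates :: "real set" where
  "zeta_ordinates = {\<gamma>. Complex (1 / 2) \<gamma> \<in> nontrivial_zeros}"

definition ordinate_mult :: "real \<Rightarrow> nat" where
  "ordinate_mult \<gamma> = nat (zorder zeta (Complex (1 / 2) \<gamma>))"

definition zero_count :: "real \<Rightarrow> real" where
  "zero_count T = (\<Sum>\<gamma> | \<gamma> \<in> zeta_ordinates \<and> 0 < \<gamma> \<and> \<gamma> \<le> T. real (ordinate_mult \<gamma>))"

definition frac_zero_count :: "real \<Rightarrow> real \<Rightarrow> real \<Rightarrow> real" where
  "frac_zero_count T \<alpha> \<beta> =
     (\<Sum>\<gamma> | \<gamma> \<in> zeta_ordinates \<and> 0 < \<gamma> \<and> \<gamma> \<le> T \<and> frac (\<gamma> * ln T / (2 * pi)) \<in> {\<alpha>..\<beta>}.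
        real (ordinate_mult \<gamma>))"

definition zero_exp_sum :: "real \<Rightarrow> real \<Rightarrow> complex" where
  "zero_exp_sum x T =
     (\<Sum>\<gamma> | \<gamma> \<in> zeta_ordinates \<and> 0 < \<gamma> \<and> \<gamma> \<le> T.
        of_nat (ordinate_mult \<gamma>) * complex_of_real x powr (\<i> * complex_of_real \<gamma>))"

definition zero_exp_sum_conjecture :: bool where
  "zero_exp_sum_conjecture \<longleftrightarrow>
     (\<forall>\<epsilon>::real. \<epsilon> > 0 \<longrightarrow> (\<exists>C::real. \<forall>x T::real. x \<ge> 2 \<longrightarrow> T \<ge> 2 \<longrightarrow>
        norm (zero_exp_sum x T) \<le>
          C * (T * x powr (- (1 / 2) + \<epsilon>) + T powr (1 / 2) * x powr \<epsilon>)))"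

end

theory Submission
  imports Defs "HOL-Real_Asymp.Real_Asymp"
begin

text \<open>
  For the points \<open>\<gamma> log T / 2\<pi>\<close> the \<open>k\<close>-th exponential sum of Weyl's
  criterion is \<open>\<Sum> T^(i k \<gamma>)\<close>, which is the sum of the conjecture with \<open>x = T^k\<close>. Taking
  \<open>\<epsilon> = 1/(20 k)\<close> there bounds it by a constant times \<open>T^(11/20)\<close>. So equidistribution follows as soon as
  \<open>N(T)\<close> exceeds \<open>T^(11/20)\<close> by a positive power of \<open>T\<close>, and the bound \<open>N(T) \<ge> T^(3/5) / 4\<close> for large
  \<open>T\<close> (\<open>zero_count_lower_bound\<close>) is enough. It follows from RH and the fact that for large \<open>T\<close> every window
  \<open>(T, T + T^(2/5))\<close> contains the imaginary part of a zero of zeta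
  (\<open>zeta_zero_in_short_window\<close>).

  Suppose that zeta has no zeros with imaginary part in such a window. On discs of radius 5 inside it a branch of
  \<open>log zeta\<close> exists, with real part \<open>O(log T)\<close> because zeta grows polynomially, and it is bounded
  near \<open>Re s = 4\<close>. Comparing these bounds (\<open>Borel_Caratheodory\<close>, \<open>two_radius_bound\<close>) gives
  \<open>log \<bar>zeta\<bar> \<le> \<eta> log T + O(1)\<close> up to \<open>Re s = -1/2\<close>, for any fixed \<open>\<eta> > 0\<close>
  (\<open>zeta_subpolynomial_of_zero_free\<close>). But the mean value of \<open>zeta(s) m^s\<close> over a long vertical segment
  is 1 on the line \<open>Re s = 2\<close>, being the coefficient of \<open>m^(-s)\<close> in the Dirichlet series, whereas
  on the line \<open>Re s = -1/2\<close> it is at most about \<open>m^(-1/2) T^\<eta>\<close>. Cauchy's theorem equates the two up to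
  boundary terms, which is absurd when \<open>m\<close> is a small power of \<open>T\<close>.

  All of this requires that zeta exists with polynomial growth to the left of \<open>Re s = 0\<close>. The
  continuation is obtained by summing Taylor expansions of \<open>(n + 1)^(1 - s) - n^(1 - s)\<close>, which expresses
  \<open>(s - 1) zeta(s)\<close> through the values of zeta at \<open>s + 1, s + 2, ...\<close> (\<open>zeta_series_recursion\<close>).

  Weyl's criterion is needed uniformly in the interval and for weights given by multiplicities. It is derived from
  trigonometric majorants of arcs (\<open>arc_trig_poly_majorant\<close>), supplied by the Stone-Weierstrass
  theorem; lower bounds for an arc come from upper bounds for its complement.
\<close>

section \<open>Series on half-planes and moderate growth\<close>

text \<open>
  The distance \<open>d\<close> from the boundary line is needed because the majorants that occur are
  multiples of \<open>\<Sum> n^(-1 - d)\<close>, which blow up as \<open>d\<close> tends to 0.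
\<close>
definition moderate_growth :: "real \<Rightarrow> (complex \<Rightarrow> complex) \<Rightarrow> bool" where
  "moderate_growth a F \<longleftrightarrow>
     (\<forall>d>0. \<exists>C A. \<forall>s. Re s \<ge> a + d \<longrightarrow> norm (F s) \<le> C * (1 + norm s) ^ A)"

lemma moderate_growthD:
  assumes "moderate_growth a F" "d > 0"
  obtains C A where "C \<ge> 0" "\<And>s. Re s \<ge> a + d \<Longrightarrow> norm (F s) \<le> C * (1 + norm s) ^ A"
proof -
  obtain C A where CA: "\<And>s. Re s \<ge> a + d \<Longrightarrow> norm (F s) \<le> C * (1 + norm s) ^ A"
    using assms unfolding moderate_growth_def by blast
  have "norm (F s) \<le> \<bar>C\<bar> * (1 + norm s) ^ A" if "Re s \<ge> a + d" for s
    using CA[OF that] by (smt (verit) mult_right_mono norm_ge_zero zero_le_power)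
  then show ?thesis using that[of "\<bar>C\<bar>" A] by auto
qed

lemma moderate_growth_const: "moderate_growth a (\<lambda>s. c)"
  unfolding moderate_growth_def
proof (intro allI impI)
  fix d :: real
  show "\<exists>C A. \<forall>s. a + d \<le> Re s \<longrightarrow> norm c \<le> C * (1 + norm s) ^ A"
    by (rule exI[of _ "norm c"], rule exI[of _ 0]) simp
qed

lemma moderate_growth_id: "moderate_growth a (\<lambda>s. s)"
  unfolding moderate_growth_def
proof (intro allI impI)
  fix d :: real
  show "\<exists>C A. \<forall>s. a + d \<le> Re s \<longrightarrow> norm s \<le> C * (1 + norm s) ^ A"
    by (rule exI[of _ 1], rule exI[of _ 1]) simp
qed

lemma moderate_growth_add:
  assumes "moderate_growth a F" "moderate_growth a G"
  shows "moderate_growth a (\<lambda>s. F s + G s)"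
  unfolding moderate_growth_def
proof (intro allI impI)
  fix d :: real assume d: "d > 0"
  obtain C A where 1: "C \<ge> 0" "\<And>s. Re s \<ge> a + d \<Longrightarrow> norm (F s) \<le> C * (1 + norm s) ^ A"
    using moderate_growthD[OF assms(1) d] by metis
  obtain C' A' where 2: "C' \<ge> 0" "\<And>s. Re s \<ge> a + d \<Longrightarrow> norm (G s) \<le> C' * (1 + norm s) ^ A'"
    using moderate_growthD[OF assms(2) d] by metis
  have "norm (F s + G s) \<le> (C + C') * (1 + norm s) ^ (A + A')" if s: "Re s \<ge> a + d" for s
  proof -
    have "(1 + norm s) ^ A \<le> (1 + norm s) ^ (A + A')" "(1 + norm s) ^ A' \<le> (1 + norm s) ^ (A + A')"
      by (auto intro!: power_increasing)
    then have "C * (1 + norm s) ^ A + C' * (1 + norm s) ^ A' \<le> (C + C') * (1 + norm s) ^ (A + A')"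
      unfolding distrib_right using 1(1) 2(1) by (intro add_mono mult_left_mono) auto
    then show ?thesis using 1(2)[OF s] 2(2)[OF s] norm_triangle_ineq[of "F s" "G s"] by linarith
  qed
  then show "\<exists>C A. \<forall>s. a + d \<le> Re s \<longrightarrow> norm (F s + G s) \<le> C * (1 + norm s) ^ A" by blast
qed

lemma moderate_growth_mult:
  assumes "moderate_growth a F" "moderate_growth a G"
  shows "moderate_growth a (\<lambda>s. F s * G s)"
  unfolding moderate_growth_def
proof (intro allI impI)
  fix d :: real assume d: "d > 0"
  obtain C A where 1: "C \<ge> 0" "\<And>s. Re s \<ge> a + d \<Longrightarrow> norm (F s) \<le> C * (1 + norm s) ^ A"
    using moderate_growthD[OF assms(1) d] by metis
  obtain C' A' where 2: "C' \<ge> 0" "\<And>s. Re s \<ge> a + d \<Longrightarrow> norm (G s) \<le> C' * (1 + norm s) ^ A'"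
    using moderate_growthD[OF assms(2) d] by metis
  have "norm (F s * G s) \<le> (C * C') * (1 + norm s) ^ (A + A')" if s: "Re s \<ge> a + d" for s
  proof -
    have "norm (F s * G s) \<le> (C * (1 + norm s) ^ A) * (C' * (1 + norm s) ^ A')"
      unfolding norm_mult using 1 2 s by (intro mult_mono) auto
    then show ?thesis by (simp add: power_add algebra_simps)
  qed
  then show "\<exists>C A. \<forall>s. a + d \<le> Re s \<longrightarrow> norm (F s * G s) \<le> C * (1 + norm s) ^ A" by blast
qed

lemma moderate_growth_minus: "moderate_growth a F \<Longrightarrow> moderate_growth a (\<lambda>s. - F s)"
  using moderate_growth_mult[OF moderate_growth_const[of a "-1"]] by simp

lemma moderate_growth_diff:
  "moderate_growth a F \<Longrightarrow> moderate_growth a G \<Longrightarrow> moderate_growth a (\<lambda>s. F s - G s)"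
  using moderate_growth_add[of a F "\<lambda>s. - G s"] moderate_growth_minus[of a G] by simp

lemma moderate_growth_sum:
  "(\<And>i. i \<in> I \<Longrightarrow> moderate_growth a (F i)) \<Longrightarrow> moderate_growth a (\<lambda>s. \<Sum>i\<in>I. F i s)"
  by (induction I rule: infinite_finite_induct)
     (auto intro: moderate_growth_const moderate_growth_add)

lemma moderate_growth_prod:
  "(\<And>i. i \<in> I \<Longrightarrow> moderate_growth a (F i)) \<Longrightarrow> moderate_growth a (\<lambda>s. \<Prod>i\<in>I. F i s)"
  by (induction I rule: infinite_finite_induct)
     (auto intro: moderate_growth_const moderate_growth_mult)

lemma moderate_growth_weaken:
  assumes "moderate_growth a F" "a \<le> b"
  shows "moderate_growth b F"
  unfolding moderate_growth_def
proof (intro allI impI)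
  fix d :: real assume d: "d > 0"
  then have d': "b - a + d > 0" using assms(2) by simp
  show "\<exists>C A. \<forall>s. b + d \<le> Re s \<longrightarrow> norm (F s) \<le> C * (1 + norm s) ^ A"
    using assms(1)[unfolded moderate_growth_def, rule_format, OF d'] by (simp add: add.commute)
qed

lemma moderate_growth_shift:
  assumes "moderate_growth a F"
  shows "moderate_growth (a - real i) (\<lambda>s. F (s + of_nat i))"
  unfolding moderate_growth_def
proof (intro allI impI)
  fix d :: real assume d: "d > 0"
  obtain C A where 1: "C \<ge> 0" "\<And>s. Re s \<ge> a + d \<Longrightarrow> norm (F s) \<le> C * (1 + norm s) ^ A"
    using moderate_growthD[OF assms(1) d] by metis
  have "norm (F (s + of_nat i)) \<le> (C * (1 + real i) ^ A) * (1 + norm s) ^ A"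
    if s: "Re s \<ge> a - real i + d" for s
  proof -
    have "norm (s + of_nat i) \<le> norm s + real i"
      by (metis norm_of_nat norm_triangle_ineq)
    then have le: "1 + norm (s + of_nat i) \<le> (1 + real i) * (1 + norm s)"
      by (simp add: algebra_simps) (smt (verit) mult_nonneg_nonneg norm_ge_zero of_nat_0_le_iff)
    have "norm (F (s + of_nat i)) \<le> C * (1 + norm (s + of_nat i)) ^ A"
      using s by (intro 1(2)) simp
    also have "\<dots> \<le> C * ((1 + real i) * (1 + norm s)) ^ A"
      using le 1(1) by (intro mult_left_mono power_mono) auto
    finally show ?thesis by (simp add: power_mult_distrib mult_ac)
  qed
  then show "\<exists>C A. \<forall>s. a - real i + d \<le> Re s \<longrightarrow> norm (F (s + of_nat i)) \<le> C * (1 + norm s) ^ A"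
    by blast
qed

lemma moderate_growth_gbinomial:
  "moderate_growth a (\<lambda>s. (1 - s) gchoose i)"
proof -
  have "moderate_growth a (\<lambda>s. inverse (fact i) * (\<Prod>j = 0..<i. 1 - s - of_nat j))"
    by (intro moderate_growth_mult moderate_growth_prod moderate_growth_const
          moderate_growth_diff moderate_growth_id)
  then show ?thesis by (simp add: gbinomial_prod_rev field_simps)
qed

text \<open>
  At distance \<open>d\<close> to the right of the boundary line the terms are dominated by multiples of
  \<open>(n + 1)^(-1 - d)\<close>, so the Weierstrass M-test applies locally and also gives the growth. Termwise
  differentiation is included because a primitive of \<open>zeta(s) m^s\<close> will be produced as such a series.
\<close>
lemma holomorphic_on_series_moderate:
  fixes u :: "nat \<Rightarrow> complex \<Rightarrow> complex"
  assumes hol: "\<And>n. u n holomorphic_on {s. Re s > a}"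
    and growth: "moderate_growth a G"
    and bound: "\<And>n s. Re s > a \<Longrightarrow> norm (u n s) \<le> norm (G s) * real (Suc n) powr (-(1 + (Re s - a)))"
  shows "(\<lambda>s. \<Sum>n. u n s) holomorphic_on {s. Re s > a}"
    and "\<And>s. Re s > a \<Longrightarrow> summable (\<lambda>n. u n s)"
    and "moderate_growth a (\<lambda>s. \<Sum>n. u n s)"
    and "\<And>s. Re s > a \<Longrightarrow> (\<lambda>n. deriv (u n) s) sums deriv (\<lambda>s. \<Sum>n. u n s) s"
proof -
  have powr_summable: "summable (\<lambda>n. real (Suc n) powr (-(1 + d)))" if "d > 0" for d :: real
    using that summable_real_powr_iff[of "-(1+d)"] by (subst summable_Suc_iff) simp
  have unif: "\<exists>C A. C \<ge> 0 \<and> (\<forall>n s. Re s \<ge> a + d \<longrightarrow>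
      norm (u n s) \<le> C * (1 + norm s) ^ A * real (Suc n) powr (-(1 + d)))" if d: "d > 0" for d
  proof -
    obtain C A where 1: "C \<ge> 0" "\<And>s. Re s \<ge> a + d \<Longrightarrow> norm (G s) \<le> C * (1 + norm s) ^ A"
      using moderate_growthD[OF growth d] by metis
    have "norm (u n s) \<le> C * (1 + norm s) ^ A * real (Suc n) powr (-(1 + d))"
      if s: "Re s \<ge> a + d" for n s
    proof -
      have "norm (u n s) \<le> norm (G s) * real (Suc n) powr (-(1 + (Re s - a)))"
        using s d by (intro bound) simp
      also have "\<dots> \<le> C * (1 + norm s) ^ A * real (Suc n) powr (-(1 + d))"
        using s d 1 by (intro mult_mono powr_mono) auto
      finally show ?thesis .
    qed
    then show ?thesis using 1(1) by blast
  qed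
  show summ: "summable (\<lambda>n. u n s)" if s: "Re s > a" for s
  proof (rule summable_comparison_test')
    show "summable (\<lambda>n. norm (G s) * real (Suc n) powr (-(1 + (Re s - a))))"
      using s by (intro summable_mult powr_summable) simp
    show "norm (u n s) \<le> norm (G s) * real (Suc n) powr (-(1 + (Re s - a)))" if "n \<ge> 0" for n
      using bound[OF s] .
  qed
  show "moderate_growth a (\<lambda>s. \<Sum>n. u n s)"
    unfolding moderate_growth_def
  proof (intro allI impI)
    fix d :: real assume d: "d > 0"
    obtain C A where 1: "C \<ge> 0" "\<And>n s. Re s \<ge> a + d \<Longrightarrow>
      norm (u n s) \<le> C * (1 + norm s) ^ A * real (Suc n) powr (-(1 + d))" using unif[OF d] by metis
    let ?Z = "\<Sum>n. real (Suc n) powr (-(1 + d))"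
    have "norm (\<Sum>n. u n s) \<le> (C * ?Z) * (1 + norm s) ^ A" if s: "Re s \<ge> a + d" for s
    proof -
      have "norm (\<Sum>n. u n s) \<le> (\<Sum>n. C * (1 + norm s) ^ A * real (Suc n) powr (-(1 + d)))"
        using 1(2)[OF s] by (intro norm_suminf_le summable_mult powr_summable d)
      also have "\<dots> = C * (1 + norm s) ^ A * ?Z" by (intro suminf_mult powr_summable d)
      finally show ?thesis by (simp add: mult_ac)
    qed
    then show "\<exists>C A. \<forall>s. a + d \<le> Re s \<longrightarrow> norm (\<Sum>n. u n s) \<le> C * (1 + norm s) ^ A" by blast
  qed
  have opn: "open {s. Re s > a}" by (rule open_halfspace_Re_gt)
  have "\<exists>g'. \<forall>s\<in>{s. Re s > a}. ((\<lambda>s. \<Sum>n. u n s) has_field_derivative g' s) (at s) \<and>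
      (\<lambda>N. \<Sum>n<N. deriv (u n) s) \<longlonglongrightarrow> g' s"
  proof (rule has_complex_derivative_uniform_sequence[OF opn])
    show "((\<lambda>s. \<Sum>n<N. u n s) has_field_derivative (\<Sum>n<N. deriv (u n) s)) (at s)"
      if "s \<in> {s. Re s > a}" for N s
      using hol opn that by (intro DERIV_sum holomorphic_derivI) auto
    fix z assume "z \<in> {s. Re s > a}"
    then have z: "Re z > a" by simp
    define d where "d = (Re z - a) / 2"
    have d: "d > 0" "Re z = a + 2 * d" using z by (simp_all add: d_def field_simps)
    obtain C A where 1: "C \<ge> 0" "\<And>n s. Re s \<ge> a + d \<Longrightarrow>
      norm (u n s) \<le> C * (1 + norm s) ^ A * real (Suc n) powr (-(1 + d))" using unif[OF d(1)] by metis
    have Re: "Re s \<ge> a + d" if "s \<in> cball z d" for s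
      using that d abs_Re_le_cmod[of "z - s"] by (auto simp: dist_norm)
    have nm: "norm s \<le> norm z + d" if "s \<in> cball z d" for s
      using that norm_triangle_ineq2[of s z] by (auto simp: dist_norm norm_minus_commute)
    have "uniform_limit (cball z d) (\<lambda>N s. \<Sum>n<N. u n s) (\<lambda>s. \<Sum>n. u n s) sequentially"
    proof (rule Weierstrass_m_test)
      show "norm (u n s) \<le> C * (1 + (norm z + d)) ^ A * real (Suc n) powr (-(1 + d))"
        if "s \<in> cball z d" for n s
      proof -
        have "C * (1 + norm s) ^ A \<le> C * (1 + (norm z + d)) ^ A"
          using nm[OF that] 1(1) by (intro mult_left_mono power_mono) auto
        then show ?thesis using 1(2)[OF Re[OF that], of n]
          by (smt (verit) mult_right_mono powr_ge_zero)
      qed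
      show "summable (\<lambda>n. C * (1 + (norm z + d)) ^ A * real (Suc n) powr (-(1 + d)))"
        by (intro summable_mult powr_summable d)
    qed
    moreover have "cball z d \<subseteq> {s. Re s > a}" using Re d by force
    ultimately show "\<exists>d>0. cball z d \<subseteq> {s. Re s > a} \<and>
        uniform_limit (cball z d) (\<lambda>N s. \<Sum>n<N. u n s) (\<lambda>s. \<Sum>n. u n s) sequentially"
      using d by blast
  qed
  then obtain g' where g': "\<And>s. Re s > a \<Longrightarrow> ((\<lambda>s. \<Sum>n. u n s) has_field_derivative g' s) (at s)"
      "\<And>s. Re s > a \<Longrightarrow> (\<lambda>n. deriv (u n) s) sums g' s"
    unfolding sums_def by blast
  show "(\<lambda>s. \<Sum>n. u n s) holomorphic_on {s. Re s > a}"
    using g'(1) opn by (auto simp: holomorphic_on_open)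
  show "(\<lambda>n. deriv (u n) s) sums deriv (\<lambda>s. \<Sum>n. u n s) s" if "Re s > a" for s
    using g'(2)[OF that] DERIV_imp_deriv[OF g'(1)[OF that]] by simp
qed

text \<open>
  The sum of \<open>n^(-s)\<close>, meaningful for \<open>Re s > 1\<close>; the analytic continuation starts from it.
\<close>
definition zeta_series :: "complex \<Rightarrow> complex" where
  "zeta_series s = (\<Sum>n. of_nat (Suc n) powr (- s))"

lemma norm_nat_powr: "norm (of_nat (Suc n) powr s :: complex) = real (Suc n) powr Re s"
  using norm_powr_real_powr[of "of_nat (Suc n)" s] by (simp del: of_nat_Suc)

text \<open>
  The sum of \<open>n^(-s)\<close>, meaningful for \<open>Re s > 1\<close>; the analytic continuation starts from it.
\<close>
lemma zeta_series:
  shows "zeta_series holomorphic_on {s. Re s > 1}"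
    and "\<And>s. Re s > 1 \<Longrightarrow> (\<lambda>n. of_nat (Suc n) powr (- s)) sums zeta_series s"
    and "moderate_growth 1 zeta_series"
proof -
  have h: "(\<lambda>s. of_nat (Suc n) powr (- s) :: complex) holomorphic_on {s. Re s > 1}" for n
    by (intro holomorphic_intros) (auto simp del: of_nat_Suc)
  have b: "norm (of_nat (Suc n) powr (- s) :: complex) \<le>
        norm (1 :: complex) * real (Suc n) powr (-(1 + (Re s - 1)))" if "Re s > 1" for n s
    by (simp only: norm_nat_powr) simp
  note * = holomorphic_on_series_moderate[OF h moderate_growth_const[of _ 1] b]
  show "zeta_series holomorphic_on {s. Re s > 1}" using *(1) unfolding zeta_series_def by simp
  show "(\<lambda>n. of_nat (Suc n) powr (- s)) sums zeta_series s" if "Re s > 1" for s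
    using *(2)[OF _ that] unfolding zeta_series_def by (simp add: summable_sums)
  show "moderate_growth 1 zeta_series" using *(3) unfolding zeta_series_def by simp
qed

text \<open>
  The remainder in the Taylor expansion of \<open>x^(1 - s)\<close> about \<open>n\<close>, to order \<open>J\<close>, at the point
  \<open>n + 1\<close>. The index is shifted by one so that the base points start at 1.
\<close>
definition taylor_rem :: "nat \<Rightarrow> nat \<Rightarrow> complex \<Rightarrow> complex" where
  "taylor_rem J n s = of_nat (Suc (Suc n)) powr (1 - s) -
     (\<Sum>j\<le>J. ((1 - s) gchoose j) * of_nat (Suc n) powr (1 - s - of_nat j))"

text \<open>
  Each derivative of \<open>x^(1 - s)\<close> gains a power of \<open>1/x\<close>. Hence the remainder of order \<open>J\<close> decays like
  \<open>n^(-s - J)\<close>, and its sum over \<open>n\<close> converges in a half-plane that moves left with \<open>J\<close>.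
\<close>
lemma norm_taylor_rem_le:
  assumes "Re s + real J > 0"
  shows "norm (taylor_rem J n s) \<le>
    norm (of_nat (Suc J) * ((1 - s) gchoose (Suc J))) * real (Suc n) powr (- Re s - real J)"
proof -
  define a where "a = 1 - s"
  define f where "f = (\<lambda>i (z::complex). (\<Prod>j<i. a - of_nat j) * z powr (a - of_nat i))"
  define S where "S = closed_segment (of_nat (Suc n)) (of_nat (Suc (Suc n)) :: complex)"
  have S: "\<exists>x. z = of_real x \<and> x \<ge> real (Suc n)" if "z \<in> S" for z
  proof -
    have "S = of_real ` closed_segment (real (Suc n)) (real (Suc (Suc n)))"
      unfolding S_def using closed_segment_of_real[of "real (Suc n)" "real (Suc (Suc n))"]
      by (simp only: of_real_of_nat_eq)
    then show ?thesis using that by (auto simp: closed_segment_eq_real_ivl)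
  qed
  have "norm (f 0 (of_nat (Suc (Suc n))) - (\<Sum>i\<le>J. f i (of_nat (Suc n)) * (of_nat (Suc (Suc n)) - of_nat (Suc n)) ^ i / (fact i)))
    \<le> (norm (\<Prod>j<Suc J. a - of_nat j) * real (Suc n) powr (- Re s - real J)) * norm (of_nat (Suc (Suc n)) - of_nat (Suc n) :: complex) ^ Suc J / fact J"
  proof (rule complex_Taylor[where S = S])
    show "convex S" by (simp add: S_def)
    show "(f i has_field_derivative f (Suc i) z) (at z within S)" if z: "z \<in> S" for i z
    proof -
      obtain x where x: "z = of_real x" "x \<ge> real (Suc n)" using S[OF z] by blast
      then have "z \<notin> \<real>\<^sub>\<le>\<^sub>0" by (auto simp: complex_nonpos_Reals_iff)
      then have "((\<lambda>z. z powr (a - of_nat i)) has_field_derivative (a - of_nat i) * z powr (a - of_nat i - 1)) (at z within S)"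
        by (auto intro!: derivative_eq_intros has_field_derivative_at_within has_field_derivative_powr)
      from DERIV_cmult[OF this, of "\<Prod>j<i. a - of_nat j"] show ?thesis
        by (simp add: f_def algebra_simps)
    qed
    show "norm (f (Suc J) z) \<le> norm (\<Prod>j<Suc J. a - of_nat j) * real (Suc n) powr (- Re s - real J)" if z: "z \<in> S" for z
    proof -
      obtain x where x: "z = of_real x" "x \<ge> real (Suc n)" using S[OF z] by blast
      have "norm (z powr (a - of_nat (Suc J))) = x powr Re (a - of_nat (Suc J))"
        using x norm_powr_real_powr[of z "a - of_nat (Suc J)"] by auto
      also have "\<dots> \<le> real (Suc n) powr (- Re s - real J)"
        using assms x by (auto simp: a_def intro!: powr_mono2')
      finally show ?thesis unfolding f_def norm_mult by (intro mult_left_mono) auto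
    qed
  qed (auto simp: S_def)
  moreover have "(\<Prod>j<i. a - of_nat j) = fact i * (a gchoose i)" for i
    by (simp add: gbinomial_mult_fact atLeast0LessThan)
  moreover have "of_nat (Suc J) * (a gchoose Suc J) = (a gchoose J) * (a - of_nat J)"
    using gbinomial_mult_1[of a J] by (simp add: algebra_simps del: of_nat_Suc)
  ultimately show ?thesis
    by (simp add: f_def taylor_rem_def a_def norm_mult del: of_nat_Suc)
       (simp add: field_simps norm_mult)
qed

section \<open>Analytic continuation of zeta\<close>

lemma taylor_rem_series:
  fixes J :: nat
  defines "a \<equiv> 1 - real J"
  shows "(\<lambda>s. \<Sum>n. taylor_rem J n s) holomorphic_on {s. Re s > a}"
    and "\<And>s. Re s > a \<Longrightarrow> summable (\<lambda>n. taylor_rem J n s)"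
    and "moderate_growth a (\<lambda>s. \<Sum>n. taylor_rem J n s)"
proof -
  have hol: "taylor_rem J n holomorphic_on {s. Re s > a}" for n
    unfolding taylor_rem_def[abs_def] gbinomial_prod_rev
    by (intro holomorphic_intros) (auto simp del: of_nat_Suc)
  have growth: "moderate_growth a (\<lambda>s. of_nat (Suc J) * ((1 - s) gchoose (Suc J)))"
    by (intro moderate_growth_mult moderate_growth_const moderate_growth_gbinomial)
  have bound: "norm (taylor_rem J n s) \<le> norm (of_nat (Suc J) * ((1 - s) gchoose (Suc J))) *
      real (Suc n) powr (-(1 + (Re s - a)))" if s: "Re s > a" for n s
  proof -
    have e: "- (1 + (Re s - a)) = - Re s - real J" by (simp add: a_def)
    show ?thesis unfolding e using s by (intro norm_taylor_rem_le) (simp add: a_def)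
  qed
  note * = holomorphic_on_series_moderate[of "taylor_rem J", OF hol growth bound]
  show "(\<lambda>s. \<Sum>n. taylor_rem J n s) holomorphic_on {s. Re s > a}"
    by (rule *(1))
  show "summable (\<lambda>n. taylor_rem J n s)" if "Re s > a" for s
    by (rule *(2)[OF _ that])
  show "moderate_growth a (\<lambda>s. \<Sum>n. taylor_rem J n s)"
    by (rule *(3))
qed

text \<open>
  The differences \<open>(n + 1)^(1 - s) - n^(1 - s)\<close> telescope to \<open>-1\<close>. When each is replaced by its
  Taylor expansion, the linear terms sum to \<open>(1 - s) zeta(s)\<close> and the term of order \<open>i + 1\<close> sums to
  a multiple of \<open>zeta(s + i)\<close>. The binomial coefficient in it has the factor \<open>s + i - 1\<close>, which cancels
  the pole; this is why the recursion is written for \<open>(s - 1) zeta(s)\<close>.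
\<close>
lemma zeta_series_recursion:
  assumes s: "Re s > 1"
  shows "(s - 1) * zeta_series s = 1 -
    (\<Sum>i=1..k. ((1 - s) gchoose i) / of_nat (Suc i) * ((s + of_nat i - 1) * zeta_series (s + of_nat i)))
    + (\<Sum>n. taylor_rem (Suc k) n s)"
proof -
  have tele: "(\<lambda>n. of_nat (Suc (Suc n)) powr (1 - s) - of_nat (Suc n) powr (1 - s)) sums (0 - of_nat (Suc 0) powr (1 - s))"
  proof (rule telescope_sums)
    have "(\<lambda>n. real (Suc n) powr (Re (1 - s))) \<longlonglongrightarrow> 0"
      using s by (intro tendsto_neg_powr filterlim_compose[OF filterlim_real_sequentially filterlim_Suc]) auto
    then show "(\<lambda>n. of_nat (Suc n) powr (1 - s)) \<longlonglongrightarrow> 0"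
      by (subst tendsto_norm_zero_iff[symmetric]) (simp only: norm_nat_powr)
  qed
  have D: "(\<lambda>n. ((1 - s) gchoose j) * of_nat (Suc n) powr (1 - s - of_nat j)) sums
       (((1 - s) gchoose j) * zeta_series (s + of_nat j - 1))" if "j \<ge> 1" for j
  proof -
    have "Re (s + of_nat j - 1) > 1" using that s by simp
    from sums_mult[OF zeta_series(2)[OF this]] show ?thesis by (simp add: algebra_simps)
  qed
  have "(\<lambda>n. (\<Sum>j=1..Suc k. ((1 - s) gchoose j) * of_nat (Suc n) powr (1 - s - of_nat j)) + taylor_rem (Suc k) n s) sums
     ((\<Sum>j=1..Suc k. ((1 - s) gchoose j) * zeta_series (s + of_nat j - 1)) + (\<Sum>n. taylor_rem (Suc k) n s))"
    using s by (intro sums_add sums_sum D summable_sums taylor_rem_series(2)) auto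
  also have "(\<lambda>n. (\<Sum>j=1..Suc k. ((1 - s) gchoose j) * of_nat (Suc n) powr (1 - s - of_nat j)) + taylor_rem (Suc k) n s)
     = (\<lambda>n. of_nat (Suc (Suc n)) powr (1 - s) - of_nat (Suc n) powr (1 - s))"
  proof
    fix n
    have "(\<Sum>j\<le>Suc k. ((1 - s) gchoose j) * of_nat (Suc n) powr (1 - s - of_nat j))
      = of_nat (Suc n) powr (1 - s) + (\<Sum>j=1..Suc k. ((1 - s) gchoose j) * of_nat (Suc n) powr (1 - s - of_nat j))"
      unfolding atMost_atLeast0 by (subst sum.atLeast_Suc_atMost) auto
    then show "(\<Sum>j=1..Suc k. ((1 - s) gchoose j) * of_nat (Suc n) powr (1 - s - of_nat j)) + taylor_rem (Suc k) n s
      = of_nat (Suc (Suc n)) powr (1 - s) - of_nat (Suc n) powr (1 - s)"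
      by (simp add: taylor_rem_def)
  qed
  finally have "(\<Sum>j=1..Suc k. ((1 - s) gchoose j) * zeta_series (s + of_nat j - 1)) + (\<Sum>n. taylor_rem (Suc k) n s) = -1"
    using sums_unique2[OF _ tele] by simp
  moreover have "(\<Sum>j=1..Suc k. ((1 - s) gchoose j) * zeta_series (s + of_nat j - 1)) =
     (1 - s) * zeta_series s + (\<Sum>i=1..k. ((1 - s) gchoose (Suc i)) * zeta_series (s + of_nat i))"
    by (subst sum.atLeast_Suc_atMost) (simp_all add: sum.shift_bounds_cl_Suc_ivl del: sum.cl_ivl_Suc)
  moreover have "(\<Sum>i=1..k. ((1 - s) gchoose (Suc i)) * zeta_series (s + of_nat i)) =
    - (\<Sum>i=1..k. ((1 - s) gchoose i) / of_nat (Suc i) * ((s + of_nat i - 1) * zeta_series (s + of_nat i)))"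
    unfolding sum_negf[symmetric]
  proof (rule sum.cong)
    fix i
    have "of_nat (Suc i) * ((1 - s) gchoose (Suc i)) = ((1 - s) gchoose i) * (1 - s - of_nat i)"
      using gbinomial_mult_1[of "1 - s" i] by (simp add: algebra_simps del: of_nat_Suc)
    then have e: "((1 - s) gchoose (Suc i)) = ((1 - s) gchoose i) * (1 - s - of_nat i) / of_nat (Suc i)"
      by (simp add: field_simps del: of_nat_Suc)
    show "((1 - s) gchoose (Suc i)) * zeta_series (s + of_nat i) =
      - (((1 - s) gchoose i) / of_nat (Suc i) * ((s + of_nat i - 1) * zeta_series (s + of_nat i)))"
      unfolding e by (simp add: field_simps del: of_nat_Suc)
  qed auto
  moreover have "S + R = - 1 \<Longrightarrow> S = (1 - s) * X + B \<Longrightarrow> B = - C \<Longrightarrow> (s - 1) * X = 1 - C + R"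
    for S R X B C :: complex
    by algebra
  ultimately show ?thesis by blast
qed

text \<open>
  The right-hand side of the recursion evaluates zeta only at points at least one unit further
  to the right, so each application extends the domain by one unit, and the growth is inherited.
\<close>
lemma zeta_continuation_halfplane:
  "\<exists>Z. Z holomorphic_on {s. Re s > 1 - real k} \<and> moderate_growth (1 - real k) Z \<and>
       (\<forall>s. Re s > 1 \<longrightarrow> Z s = (s - 1) * zeta_series s)"
proof (induction k)
  case 0
  have "(\<lambda>s. (s - 1) * zeta_series s) holomorphic_on {s. Re s > 1}"
    by (intro holomorphic_intros zeta_series)
  moreover have "moderate_growth 1 (\<lambda>s. (s - 1) * zeta_series s)"
    by (intro moderate_growth_mult moderate_growth_diff moderate_growth_const moderate_growth_id zeta_series)
  ultimately show ?case by (intro exI[of _ "\<lambda>s. (s - 1) * zeta_series s"]) simp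
next
  case (Suc k)
  then obtain Z where Z: "Z holomorphic_on {s. Re s > 1 - real k}" "moderate_growth (1 - real k) Z"
    "\<And>s. Re s > 1 \<Longrightarrow> Z s = (s - 1) * zeta_series s" by blast
  \<comment> \<open>the recursion, read as a definition to the left of the known domain\<close>
  define Z' where "Z' = (\<lambda>s. 1 - (\<Sum>i=1..k. ((1 - s) gchoose i) / of_nat (Suc i) * Z (s + of_nat i))
    + (\<Sum>n. taylor_rem (Suc k) n s))"
  have "Z' holomorphic_on {s. Re s > 1 - real (Suc k)}"
    unfolding Z'_def gbinomial_prod_rev
  proof (intro holomorphic_intros taylor_rem_series)
    fix i assume "i \<in> {1..k}"
    then have "(\<lambda>s. s + of_nat i) ` {s. Re s > 1 - real (Suc k)} \<subseteq> {s. Re s > 1 - real k}" by auto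
    from holomorphic_on_compose_gen[OF _ Z(1) this]
    show "(\<lambda>s. Z (s + of_nat i)) holomorphic_on {s. Re s > 1 - real (Suc k)}"
      by (simp add: o_def holomorphic_intros)
  qed (auto simp del: of_nat_Suc)
  moreover have "moderate_growth (1 - real (Suc k)) Z'"
    unfolding Z'_def divide_inverse
  proof (intro moderate_growth_add moderate_growth_diff moderate_growth_sum moderate_growth_mult
      moderate_growth_const moderate_growth_gbinomial taylor_rem_series)
    fix i assume "i \<in> {1..k}"
    then show "moderate_growth (1 - real (Suc k)) (\<lambda>s. Z (s + of_nat i))"
      using moderate_growth_weaken[OF moderate_growth_shift[OF Z(2), of i]] by simp
  qed
  moreover have "Z' s = (s - 1) * zeta_series s" if s: "Re s > 1" for s
  proof -
    have "Z (s + of_nat i) = (s + of_nat i - 1) * zeta_series (s + of_nat i)" for i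
      using s by (intro Z(3)) simp
    then show ?thesis unfolding Z'_def zeta_series_recursion[OF s, of k] by simp
  qed
  ultimately show ?case by blast
qed

text \<open>
  By the identity theorem the continuations to the various half-planes agree where they overlap.
\<close>
lemma zeta_continuation_entire:
  "\<exists>Z. Z holomorphic_on UNIV \<and> (\<forall>s. Re s > 1 \<longrightarrow> Z s = (s - 1) * zeta_series s)"
proof -
  define H where "H = (\<lambda>k. {s::complex. Re s > 1 - real k})"
  have "\<forall>k. \<exists>Z. Z holomorphic_on H k \<and> (\<forall>s. Re s > 1 \<longrightarrow> Z s = (s - 1) * zeta_series s)"
    using zeta_continuation_halfplane unfolding H_def by blast
  then obtain Z where Z: "\<And>k. Z k holomorphic_on H k"
      "\<And>k s. Re s > 1 \<Longrightarrow> Z k s = (s - 1) * zeta_series s"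
    by metis
  have H: "open (H k)" "connected (H k)" "H 0 \<noteq> {}" for k
    unfolding H_def
    by (auto intro!: open_halfspace_Re_gt convex_connected convex_halfspace_Re_gt exI[of _ 2])
  have agree: "Z k s = Z l s" if "k \<le> l" "s \<in> H k" for k l s
  proof (rule analytic_continuation_open[of "H 0" "H k" "Z k" "Z l"])
    show "Z l holomorphic_on H k"
      using that by (intro holomorphic_on_subset[OF Z(1)[of l]]) (auto simp: H_def)
  qed (use H that Z in \<open>auto simp: H_def open_halfspace_Re_gt\<close>)
  define F where "F = (\<lambda>s. Z (LEAST k. s \<in> H k) s)"
  have ex: "\<exists>k. s \<in> H k" for s
  proof -
    obtain k where "real k > 1 - Re s" using reals_Archimedean2 by blast
    then show ?thesis by (intro exI[of _ k]) (simp add: H_def)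
  qed
  have F: "F s = Z k s" if "s \<in> H k" for k s
    using agree[of "LEAST k. s \<in> H k" k s] LeastI_ex[OF ex[of s]] Least_le[of "\<lambda>k. s \<in> H k", OF that]
    by (simp add: F_def)
  have "F holomorphic_on \<Union>(range H)"
  proof (rule holomorphic_on_UN_open)
    show "F holomorphic_on H k" for k
      using Z(1)[of k] F by (subst holomorphic_cong[where g = "Z k"]) auto
  qed (use H in auto)
  moreover have "\<Union>(range H) = UNIV" using ex by blast
  moreover have "F s = (s - 1) * zeta_series s" if "Re s > 1" for s
    using F[of s 0] Z(2)[OF that, of 0] that by (simp add: H_def)
  ultimately show ?thesis by auto
qed

text \<open>
  Since zeta is picked by the choice operator, its defining properties are available only now
  that some function is known to satisfy them.
\<close>
lemma zeta_characterization:
  "zeta holomorphic_on (- {1}) \<and>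
   (\<forall>s. Re s > 1 \<longrightarrow> (\<lambda>n. of_nat (Suc n) powr (- s)) sums zeta s)"
proof -
  let ?P = "\<lambda>f. f holomorphic_on (- {1}) \<and>
             (\<forall>s. Re s > 1 \<longrightarrow> (\<lambda>n. of_nat (Suc n) powr (- s)) sums f s)"
  obtain Z where Z: "Z holomorphic_on UNIV" "\<And>s. Re s > 1 \<Longrightarrow> Z s = (s - 1) * zeta_series s"
    using zeta_continuation_entire by blast
  define f where "f = (\<lambda>s. Z s / (s - 1))"
  have "f holomorphic_on (- {1})"
    unfolding f_def by (intro holomorphic_intros holomorphic_on_subset[OF Z(1)]) auto
  moreover have "(\<lambda>n. of_nat (Suc n) powr (- s)) sums f s" if s: "Re s > 1" for s
  proof -
    have "s \<noteq> 1" using s by auto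
    then have "f s = zeta_series s" by (simp add: f_def Z(2)[OF s])
    then show ?thesis using zeta_series(2)[OF s] by simp
  qed
  ultimately have "\<exists>f. ?P f" by blast
  then show ?thesis unfolding zeta_def by (rule someI_ex[of ?P])
qed

lemmas zeta_holomorphic = zeta_characterization[THEN conjunct1]
lemmas zeta_sums = zeta_characterization[THEN conjunct2, rule_format]

lemma zeta_growth:
  obtains C A where "C \<ge> 0"
    "\<And>s. Re s \<ge> b \<Longrightarrow> norm (s - 1) \<ge> 1 \<Longrightarrow> norm (zeta s) \<le> C * (1 + norm s) ^ A"
proof -
  obtain k where k: "real k > 1 - b" using reals_Archimedean2 by blast
  define H where "H = {s::complex. Re s > 1 - real k}"
  obtain Z where Z: "Z holomorphic_on H" "moderate_growth (1 - real k) Z"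
      "\<And>s. Re s > 1 \<Longrightarrow> Z s = (s - 1) * zeta_series s"
    using zeta_continuation_halfplane[of k] unfolding H_def by blast
  have eq: "(s - 1) * zeta s = Z s" if "s \<in> H - {1}" for s
  proof (rule analytic_continuation_open[of "{s. Re s > 1}" "H - {1}" "\<lambda>s. (s - 1) * zeta s" Z])
    show "open (H - {1})" unfolding H_def by (intro open_Diff open_halfspace_Re_gt) auto
    show "connected (H - {1})" unfolding H_def
      by (intro connected_open_delete open_halfspace_Re_gt convex_connected convex_halfspace_Re_gt) auto
    show "{s. Re s > 1} \<noteq> {}" by (auto intro!: exI[of _ 2])
    show "(\<lambda>s. (s - 1) * zeta s) holomorphic_on H - {1}"
      by (intro holomorphic_intros holomorphic_on_subset[OF zeta_holomorphic]) auto
    show "Z holomorphic_on H - {1}" by (rule holomorphic_on_subset[OF Z(1)]) auto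
    show "(z - 1) * zeta z = Z z" if "z \<in> {s. Re s > 1}" for z
      using that zeta_sums[of z] zeta_series(2)[of z] Z(3)[of z] sums_unique2 by force
  qed (use that in \<open>auto simp: H_def open_halfspace_Re_gt\<close>)
  have "b - (1 - real k) > 0" using k by simp
  then obtain C A where CA: "C \<ge> 0"
      "\<And>s. Re s \<ge> (1 - real k) + (b - (1 - real k)) \<Longrightarrow> norm (Z s) \<le> C * (1 + norm s) ^ A"
    using moderate_growthD[OF Z(2)] by metis
  show ?thesis
  proof (rule that[OF CA(1)])
    fix s assume s: "Re s \<ge> b" "norm (s - 1) \<ge> 1"
    have "s \<noteq> 1" using s(2) by auto
    have "norm (zeta s) \<le> norm (s - 1) * norm (zeta s)"
      using mult_right_mono[OF s(2), of "norm (zeta s)"] by simp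
    also have "\<dots> = norm (Z s)" using eq[of s] s k \<open>s \<noteq> 1\<close>
      by (simp add: H_def flip: norm_mult)
    also have "\<dots> \<le> C * (1 + norm s) ^ A" using s(1) by (intro CA(2)) simp
    finally show "norm (zeta s) \<le> C * (1 + norm s) ^ A" .
  qed
qed

section \<open>Zeta in zero-free discs\<close>

text \<open>
  The map \<open>u \<mapsto> u / (2 P - u)\<close> sends the half-plane \<open>Re u < P\<close> into the unit disc and fixes 0, so Schwarz's
  lemma applies to its composition with \<open>f - f c\<close>. The summand 1 in \<open>P = M + B + 1\<close> makes the
  inequality on real parts strict.
\<close>
lemma Borel_Caratheodory:
  assumes holf: "f holomorphic_on ball c R" and r: "0 \<le> r" "r < R"
    and M: "\<And>z. z \<in> ball c R \<Longrightarrow> Re (f z) \<le> M" "M \<ge> 0"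
    and B: "norm (f c) \<le> B" and w: "w \<in> cball c r"
  shows "norm (f w) \<le> B + 2 * (M + B + 1) * r / (R - r)"
proof -
  define P where "P = M + B + 1"
  have B0: "B \<ge> 0" using B norm_ge_zero[of "f c"] by linarith
  have P: "P > 0" using B0 M(2) by (simp add: P_def)
  have R: "R > 0" using r by simp
  define h where "h = (\<lambda>z. f (c + of_real R * z) - f c)"
  have im: "c + of_real R * z \<in> ball c R" if "norm z < 1" for z
    using that R by (simp add: dist_norm norm_mult)
  have Reh: "Re (h z) < P" if "norm z < 1" for z
    using M(1)[OF im[OF that]] B abs_Re_le_cmod[of "f c"] by (simp add: h_def P_def)
  \<comment> \<open>a point of the half-plane \<open>Re u < P\<close> is closer to 0 than to \<open>2 P\<close>\<close>
  have lt: "norm (h z) < norm (of_real (2 * P) - h z)" if "norm z < 1" for z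
  proof (rule power2_less_imp_less)
    have "0 < 4 * P * (P - Re (h z))" using Reh[OF that] P by simp
    then show "(norm (h z))\<^sup>2 < (norm (of_real (2 * P) - h z))\<^sup>2"
      unfolding cmod_power2 by (simp add: power2_eq_square algebra_simps)
  qed simp
  define \<phi> where "\<phi> = (\<lambda>z. h z / (of_real (2 * P) - h z))"
  have nz: "of_real (2 * P) - h z \<noteq> 0" if "norm z < 1" for z
    using lt[OF that] by fastforce
  have "(f \<circ> (\<lambda>z. c + of_real R * z)) holomorphic_on ball 0 1"
    by (rule holomorphic_on_compose_gen[OF _ holf]) (use im in \<open>auto intro!: holomorphic_intros\<close>)
  then have holh: "h holomorphic_on ball 0 1"
    unfolding h_def o_def by (intro holomorphic_intros)
  have hol\<phi>: "\<phi> holomorphic_on ball 0 1"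
    unfolding \<phi>_def using nz by (intro holomorphic_intros holh) auto
  define \<xi> where "\<xi> = (w - c) / of_real R"
  have wr: "norm (w - c) \<le> r" using w by (simp add: dist_norm norm_minus_commute)
  have \<xi>: "norm \<xi> \<le> r / R" "norm \<xi> < 1"
    using wr r R by (simp_all add: \<xi>_def norm_divide divide_simps)
  have "norm (\<phi> \<xi>) \<le> norm \<xi>"
  proof (rule Schwarz_Lemma(1)[OF hol\<phi> _ _ \<xi>(2)])
    show "\<phi> 0 = 0" by (simp add: \<phi>_def h_def)
    show "norm (\<phi> z) < 1" if "norm z < 1" for z
      using lt[OF that] nz[OF that] by (simp add: \<phi>_def norm_divide divide_simps)
  qed
  then have \<phi>\<xi>: "norm (\<phi> \<xi>) \<le> r / R" using \<xi>(1) by linarith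
  have "h \<xi> = \<phi> \<xi> * (of_real (2 * P) - h \<xi>)"
    using nz[OF \<xi>(2)] by (simp add: \<phi>_def)
  then have "norm (h \<xi>) \<le> norm (\<phi> \<xi>) * norm (of_real (2 * P) - h \<xi>)"
    by (metis norm_mult order_refl)
  also have "\<dots> \<le> (r / R) * (2 * P + norm (h \<xi>))"
  proof (rule mult_mono[OF \<phi>\<xi>])
    show "norm (of_real (2 * P) - h \<xi>) \<le> 2 * P + norm (h \<xi>)"
      using norm_triangle_ineq4[of "of_real (2 * P)" "h \<xi>"] P by simp
  qed (use r R in auto)
  finally have "norm (h \<xi>) * (R - r) \<le> 2 * P * r"
    using R by (simp add: field_simps)
  then have "norm (h \<xi>) \<le> 2 * P * r / (R - r)"
    using r by (simp add: field_simps)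
  moreover have "h \<xi> = f w - f c" using R by (simp add: h_def \<xi>_def)
  ultimately show ?thesis
    using norm_triangle_ineq2[of "f w" "f c"] B by (simp add: P_def)
qed

text \<open>
  A crude but sufficient form of the three circles theorem: the first Taylor coefficients are
  bounded through the small disc and the remaining ones through the large disc. The point is that the
  large bound \<open>M\<close> enters with an arbitrarily small factor while \<open>D\<close> does not depend on \<open>f\<close>.
\<close>
lemma two_radius_bound:
  fixes r0 r R \<eta> :: real
  assumes "0 < r0" "0 \<le> r" "r < R" "\<eta> > 0"
  obtains D where "D \<ge> 0"
    "\<And>f c B M w. f holomorphic_on cball c R \<Longrightarrow> r0 \<le> R \<Longrightarrow>
       (\<And>z. z \<in> cball c r0 \<Longrightarrow> norm (f z) \<le> B) \<Longrightarrow>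
       (\<And>z. z \<in> cball c R \<Longrightarrow> norm (f z) \<le> M) \<Longrightarrow> w \<in> cball c r \<Longrightarrow>
       norm (f w) \<le> D * B + \<eta> * M"
proof -
  define q where "q = r / R"
  have R: "R > 0" using assms by simp
  have q: "0 \<le> q" "q < 1" using assms R unfolding q_def by (simp_all add: pos_divide_less_eq)
  have "(\<lambda>n. q ^ n) \<longlonglongrightarrow> 0" using q by (intro LIMSEQ_power_zero) simp
  moreover have "0 < \<eta> * (1 - q)" using q assms by simp
  ultimately have "eventually (\<lambda>n. q ^ n < \<eta> * (1 - q)) sequentially"
    by (rule order_tendstoD(2))
  then obtain N where N: "q ^ N < \<eta> * (1 - q)" by (auto simp: eventually_sequentially)
  \<comment> \<open>the choice of \<open>N\<close> makes the tail of the geometric series with ratio \<open>q\<close> at most \<open>\<eta>\<close>\<close>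
  define D where "D = (\<Sum>n<N. (r / r0) ^ n)"
  show ?thesis
  proof (rule that)
    show "D \<ge> 0" unfolding D_def using assms by (intro sum_nonneg) auto
    fix f :: "complex \<Rightarrow> complex" and c w :: complex and B M :: real
    assume f: "f holomorphic_on cball c R" and r0R: "r0 \<le> R"
      and B: "\<And>z. z \<in> cball c r0 \<Longrightarrow> norm (f z) \<le> B"
      and M: "\<And>z. z \<in> cball c R \<Longrightarrow> norm (f z) \<le> M" and w: "w \<in> cball c r"
    have M0: "M \<ge> 0" using M[of c] R norm_ge_zero[of "f c"] by (simp del: norm_ge_zero)
    have B0: "B \<ge> 0" using B[of c] assms(1) norm_ge_zero[of "f c"] by (simp del: norm_ge_zero)
    have wr: "norm (w - c) \<le> r" using w by (simp add: dist_norm norm_minus_commute)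
    define a where "a = (\<lambda>n. (deriv ^^ n) f c / fact n)"
    have Cauchy: "norm (a n) \<le> K / \<rho> ^ n"
      if "0 < \<rho>" "\<rho> \<le> R" "\<And>z. z \<in> cball c \<rho> \<Longrightarrow> norm (f z) \<le> K" for n K \<rho>
    proof -
      have "cball c \<rho> \<subseteq> cball c R" using that by auto
      then have h: "f holomorphic_on cball c \<rho>" using f holomorphic_on_subset by blast
      have "norm ((deriv ^^ n) f c) \<le> fact n * K / \<rho> ^ n"
        using that h
        by (intro Cauchy_inequality holomorphic_on_subset[OF h ball_subset_cball]
              holomorphic_on_imp_continuous_on) (auto simp: dist_norm)
      then have "norm ((deriv ^^ n) f c) / fact n \<le> (fact n * K / \<rho> ^ n) / fact n"
        by (intro divide_right_mono) auto
      then show ?thesis by (simp add: a_def norm_divide)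
    qed
    have t1: "norm (a n * (w - c) ^ n) \<le> B * (r / r0) ^ n" for n
    proof -
      have "norm (a n * (w - c) ^ n) \<le> (B / r0 ^ n) * r ^ n"
        unfolding norm_mult norm_power using Cauchy[OF assms(1) r0R B, of n] wr assms B0
        by (intro mult_mono power_mono divide_nonneg_nonneg zero_le_power) simp_all
      then show ?thesis by (simp add: power_divide)
    qed
    have t2: "norm (a n * (w - c) ^ n) \<le> M * q ^ n" for n
    proof -
      have "norm (a n * (w - c) ^ n) \<le> (M / R ^ n) * r ^ n"
        unfolding norm_mult norm_power using Cauchy[OF R _ M, of n] wr assms M0 R
        by (intro mult_mono power_mono divide_nonneg_nonneg zero_le_power) simp_all
      then show ?thesis by (simp add: q_def power_divide)
    qed
    have "(\<lambda>n. a n * (w - c) ^ n) sums f w"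
      unfolding a_def
      by (rule holomorphic_power_series[where r = R])
         (use f ball_subset_cball holomorphic_on_subset wr assms in \<open>auto simp: dist_norm norm_minus_commute\<close>)
    then have sw: "summable (\<lambda>n. a n * (w - c) ^ n)" "f w = (\<Sum>n. a n * (w - c) ^ n)"
      by (simp_all add: sums_iff)
    have split: "f w = (\<Sum>n. a (n + N) * (w - c) ^ (n + N)) + (\<Sum>n<N. a n * (w - c) ^ n)"
      unfolding sw(2) by (rule suminf_split_initial_segment[OF sw(1)])
    have "norm (\<Sum>n<N. a n * (w - c) ^ n) \<le> (\<Sum>n<N. B * (r / r0) ^ n)"
      using t1 by (intro sum_norm_le) auto
    also have "\<dots> = D * B" by (simp add: D_def sum_distrib_left mult.commute)
    finally have p1: "norm (\<Sum>n<N. a n * (w - c) ^ n) \<le> D * B" .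
    have geo: "(\<lambda>n. M * q ^ (n + N)) sums (M * q ^ N * (1 / (1 - q)))"
      using sums_mult[OF geometric_sums[of q], of "M * q ^ N"] q by (simp add: power_add mult_ac)
    have "norm (\<Sum>n. a (n + N) * (w - c) ^ (n + N)) \<le> (\<Sum>n. M * q ^ (n + N))"
      using t2 by (intro norm_suminf_le sums_summable[OF geo])
    also have "\<dots> = M * (q ^ N * (1 / (1 - q)))" using sums_unique[OF geo] by (simp add: mult.assoc)
    also have "\<dots> \<le> M * \<eta>"
      using N q M0 by (intro mult_left_mono) (auto simp: divide_simps)
    finally show "norm (f w) \<le> D * B + \<eta> * M"
      using p1 split norm_triangle_ineq[of "\<Sum>n. a (n + N) * (w - c) ^ (n + N)" "\<Sum>n<N. a n * (w - c) ^ n"]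
      by (simp add: mult.commute)
  qed
qed

lemma zeta_near_one:
  assumes "Re s \<ge> 3"
  shows "norm (zeta s - 1) \<le> 1 / 2"
proof -
  have sums: "(\<lambda>n. of_nat (Suc n) powr (- s)) sums zeta s"
    using assms by (intro zeta_sums) simp
  then have "(\<lambda>n. of_nat (Suc (Suc n)) powr (- s)) sums (zeta s - of_nat (Suc 0) powr (- s))"
    by (subst sums_Suc_iff) simp
  then have eq: "zeta s - 1 = (\<Sum>n. of_nat (Suc (Suc n)) powr (- s))"
    using sums_unique by fastforce
  have tele: "(\<lambda>n. inverse (real (Suc n)) / 2 - inverse (real (Suc (Suc n))) / 2) sums (inverse (real (Suc 0)) / 2 - 0 / 2)"
    by (intro telescope_sums' tendsto_divide LIMSEQ_inverse_real_of_nat tendsto_const) auto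
  have "norm (\<Sum>n. of_nat (Suc (Suc n)) powr (- s)) \<le> (\<Sum>n. inverse (real (Suc n)) / 2 - inverse (real (Suc (Suc n))) / 2)"
  proof (rule norm_suminf_le[OF _ sums_summable[OF tele]])
    fix n
    have "norm (of_nat (Suc (Suc n)) powr (- s)) = real (Suc (Suc n)) powr (- Re s)"
      by (simp only: norm_nat_powr) simp
    also have "\<dots> \<le> real (Suc (Suc n)) powr (- 3)"
      using assms by (intro powr_mono) auto
    also have "\<dots> = 1 / (real n + 2) ^ 3"
      by (simp add: powr_minus divide_inverse powr_numeral add.commute)
    also have "\<dots> \<le> 1 / (2 * (real n + 1) * (real n + 2))"
    proof (rule divide_left_mono)
      have "(real n + 2) ^ 3 - 2 * (real n + 1) * (real n + 2) = (real n + 2) * ((real n)\<^sup>2 + 2 * real n + 2)"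
        by (simp add: power2_eq_square power3_eq_cube algebra_simps)
      also have "\<dots> \<ge> 0" by simp
      finally show "2 * (real n + 1) * (real n + 2) \<le> (real n + 2) ^ 3" by simp
    qed auto
    also have "\<dots> = inverse (real (Suc n)) / 2 - inverse (real (Suc (Suc n))) / 2"
    proof -
      have "1 / (2 * x * (x + 1)) = inverse x / 2 - inverse (x + 1) / 2" if "x > 0" for x :: real
        using that by (simp add: field_simps)
      from this[of "real n + 1"] show ?thesis by (simp add: add_ac)
    qed
    finally show "norm (of_nat (Suc (Suc n)) powr (- s)) \<le> inverse (real (Suc n)) / 2 - inverse (real (Suc (Suc n))) / 2" .
  qed
  also have "\<dots> = 1 / 2" using sums_unique[OF tele] by simp
  finally show ?thesis unfolding eq .
qed

text \<open>
  The logarithm of zeta on the disc is bounded absolutely near the centre, where zeta is close to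
  1, and by a multiple of \<open>log t\<close> on a disc of radius \<open>19/4\<close>. In between, on radius \<open>9/2\<close>, the
  multiple of \<open>log t\<close> can therefore be made as small as desired. Radius \<open>9/2\<close> about \<open>4 + i t\<close> reaches the line
  \<open>Re s = -1/2\<close>; what matters is that this is to the left of the imaginary axis.
\<close>
lemma zeta_subpolynomial_of_zero_free:
  assumes \<eta>: "\<eta> > 0"
  obtains D where "D \<ge> 1"
    "\<And>t s. t \<ge> 10 \<Longrightarrow> (\<And>z. z \<in> ball (Complex 4 t) 5 \<Longrightarrow> zeta z \<noteq> 0) \<Longrightarrow>
        s \<in> cball (Complex 4 t) (9/2) \<Longrightarrow> norm (zeta s) \<le> D * t powr \<eta>"
proof -
  obtain C A where CA: "C \<ge> 0"
    "\<And>s. Re s \<ge> -1 \<Longrightarrow> norm (s - 1) \<ge> 1 \<Longrightarrow> norm (zeta s) \<le> C * (1 + norm s) ^ A"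
    using zeta_growth[of "-1"] by metis
  define K where "K = ln (max C 1) + real A * ln 2 + real A"
  have K: "K \<ge> 0" by (simp add: K_def)
  \<comment> \<open>the constants that two applications of \<open>Borel_Caratheodory\<close> produce below: 19 is the bound near the centre, and passing from radius 5 to \<open>19/4\<close> costs a factor 38\<close>
  define K2 where "K2 = 233 + 38 * K"
  have K2: "K2 > 0" using K by (simp add: K2_def)
  obtain D where D: "D \<ge> 0"
    "\<And>f c B M w. f holomorphic_on cball c (19/4) \<Longrightarrow> (1/2::real) \<le> 19/4 \<Longrightarrow>
       (\<And>z. z \<in> cball c (1/2) \<Longrightarrow> norm (f z) \<le> B) \<Longrightarrow>
       (\<And>z. z \<in> cball c (19/4) \<Longrightarrow> norm (f z) \<le> M) \<Longrightarrow> w \<in> cball c (9/2) \<Longrightarrow>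
       norm (f w) \<le> D * B + (\<eta> / K2) * M"
    using two_radius_bound[of "1/2" "9/2" "19/4" "\<eta> / K2"] \<eta> K2 by auto
  show ?thesis
  proof (rule that[of "exp (19 * D)"])
    show "exp (19 * D) \<ge> 1" using D(1) by simp
    fix t :: real and s :: complex
    assume t: "t \<ge> 10" and nz: "\<And>z. z \<in> ball (Complex 4 t) 5 \<Longrightarrow> zeta z \<noteq> 0"
      and s: "s \<in> cball (Complex 4 t) (9/2)"
    define c where "c = Complex 4 t"
    have lnt: "ln t \<ge> 1" using t exp_le by (subst ln_ge_iff) auto
    have reg: "Re z \<ge> -1 \<and> norm (z - 1) \<ge> 1 \<and> 1 + norm z \<le> 2 * t" if "z \<in> ball c 5" for z
    proof -
      have d: "norm (z - c) < 5" using that by (simp add: dist_norm norm_minus_commute)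
      have 1: "Re z \<ge> -1" using abs_Re_le_cmod[of "z - c"] d by (simp add: c_def)
      have 2: "Im z \<ge> 5" using abs_Im_le_cmod[of "z - c"] d t by (simp add: c_def)
      have 3: "norm (z - 1) \<ge> 1" using abs_Im_le_cmod[of "z - 1"] 2 by simp
      have "norm c \<le> 4 + t" using cmod_le[of c] t by (simp add: c_def)
      then have "1 + norm z \<le> 2 * t" using norm_triangle_ineq2[of z c] d t by simp
      then show ?thesis using 1 3 by simp
    qed
    have "zeta holomorphic_on ball c 5"
      by (rule holomorphic_on_subset[OF zeta_holomorphic]) (use reg in force)
    then obtain g where g: "g holomorphic_on ball c 5" "\<And>z. z \<in> ball c 5 \<Longrightarrow> zeta z = exp (g z)"
      using contractible_imp_holomorphic_log[of zeta "ball c 5"] nz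
      by (metis c_def convex_ball convex_imp_contractible)
    \<comment> \<open>the branch of the logarithm that is principal, hence bounded, at the centre\<close>
    define f where "f = (\<lambda>z. g z - g c + Ln (zeta c))"
    have cz: "zeta c \<noteq> 0" using nz[of c] by (simp add: c_def)
    have f: "f holomorphic_on ball c 5" unfolding f_def by (intro holomorphic_intros g)
    have ef: "exp (f z) = zeta z" if "z \<in> ball c 5" for z
      using that cz g(2)[of c] g(2)[OF that] by (simp add: f_def exp_add exp_diff)
    have Ref: "Re (f z) = ln (norm (zeta z))" if "z \<in> ball c 5" for z
      using ef[OF that] by (metis norm_exp_eq_Re ln_exp)
    have n1: "1/2 \<le> norm (zeta z) \<and> norm (zeta z) \<le> 3/2" if "Re z \<ge> 3" for z
      using zeta_near_one[OF that] norm_triangle_ineq2[of "zeta z" 1] norm_triangle_ineq2[of 1 "zeta z"]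
      by (simp add: norm_minus_commute)
    have l32: "ln (3/2::real) \<le> 1" using ln_le_minus_one[of "3/2"] by simp
    have fc: "norm (f c) \<le> 5"
    proof -
      have "norm (f c) = norm (Ln (zeta c))" by (simp add: f_def)
      also have "\<dots> \<le> \<bar>Re (Ln (zeta c))\<bar> + \<bar>Im (Ln (zeta c))\<bar>" by (rule cmod_le)
      also have "\<bar>Im (Ln (zeta c))\<bar> \<le> pi"
        using mpi_less_Im_Ln[OF cz] Im_Ln_le_pi[OF cz] by linarith
      also have "\<bar>Re (Ln (zeta c))\<bar> \<le> 1"
      proof -
        have b: "1/2 \<le> norm (zeta c)" "norm (zeta c) \<le> 3/2" using n1[of c] by (auto simp: c_def)
        have "ln (norm (zeta c)) \<le> ln (3/2)" using b by (subst ln_le_cancel_iff) auto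
        moreover have "ln (1/2) \<le> ln (norm (zeta c))" using b by (subst ln_le_cancel_iff) auto
        moreover have "ln (1/2::real) = - ln 2" by (simp add: ln_div)
        moreover have "ln (2::real) \<le> 1" using ln_le_minus_one[of "2::real"] by simp
        moreover have "Re (Ln (zeta c)) = ln (norm (zeta c))" using cz by simp
        ultimately show ?thesis using l32 by linarith
      qed
      finally show ?thesis using pi_less_4 by simp
    qed
    have small: "norm (f z) \<le> 19" if "z \<in> cball c (1/2)" for z
    proof -
      have "norm (f z) \<le> 5 + 2 * (1 + 5 + 1) * (1/2) / (1 - 1/2)"
      proof (rule Borel_Caratheodory[OF holomorphic_on_subset[OF f]])
        fix w assume w: "w \<in> ball c 1"
        have "Re w \<ge> 3" using w abs_Re_le_cmod[of "c - w"] by (simp add: c_def dist_norm)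
        moreover have "w \<in> ball c 5" using w by simp
        moreover have "ln (norm (zeta w)) \<le> ln (3/2)"
          using n1[OF \<open>Re w \<ge> 3\<close>] by (subst ln_le_cancel_iff) auto
        ultimately have "Re (f w) \<le> ln (3/2)" using Ref[of w] by simp
        then show "Re (f w) \<le> 1" using l32 by linarith
      qed (use that fc in auto)
      then show ?thesis by simp
    qed
    have large: "norm (f z) \<le> K2 * ln t" if "z \<in> cball c (19/4)" for z
    proof -
      have "norm (f z) \<le> 5 + 2 * (K * ln t + 5 + 1) * (19/4) / (5 - 19/4)"
      proof (rule Borel_Caratheodory[OF f])
        fix w assume w: "w \<in> ball c 5"
        have zw: "norm (zeta w) > 0" using nz w by (simp add: c_def)
        have "norm (zeta w) \<le> C * (1 + norm w) ^ A" using reg[OF w] by (intro CA(2)) auto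
        also have "\<dots> \<le> max C 1 * (2 * t) ^ A"
          using reg[OF w] t by (intro mult_mono power_mono) auto
        finally have "ln (norm (zeta w)) \<le> ln (max C 1 * (2 * t) ^ A)"
          using zw t by (subst ln_le_cancel_iff) (auto simp: less_max_iff_disj)
        also have "\<dots> = ln (max C 1) + real A * ln 2 + real A * ln t"
          using t by (simp add: ln_mult ln_realpow algebra_simps)
        also have "\<dots> \<le> (ln (max C 1) + real A * ln 2) * ln t + real A * ln t"
          using lnt mult_left_mono[OF lnt, of "ln (max C 1) + real A * ln 2"] by simp
        also have "\<dots> = K * ln t" by (simp add: K_def algebra_simps)
        finally show "Re (f w) \<le> K * ln t" using Ref[OF w] by simp
      qed (use that fc K lnt in auto)
      also have "\<dots> = 233 + 38 * K * ln t" by (simp add: algebra_simps)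
      also have "\<dots> \<le> K2 * ln t" using lnt K by (simp add: K2_def algebra_simps)
      finally show ?thesis .
    qed
    have "norm (f s) \<le> D * 19 + (\<eta> / K2) * (K2 * ln t)"
    proof (rule D(2)[of f c])
      show "f holomorphic_on cball c (19/4)" by (rule holomorphic_on_subset[OF f]) auto
    qed (use small large s in \<open>auto simp: c_def\<close>)
    then have "Re (f s) \<le> 19 * D + \<eta> * ln t"
      using K2 complex_Re_le_cmod[of "f s"] by simp
    then have "exp (Re (f s)) \<le> exp (19 * D) * t powr \<eta>"
      using t by (simp add: powr_def flip: exp_add)
    moreover have "s \<in> ball c 5" using s by (simp add: c_def)
    ultimately show "norm (zeta s) \<le> exp (19 * D) * t powr \<eta>"
      using ef[of s] by (metis norm_exp_eq_Re)
  qed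
qed

section \<open>Zeros in short windows\<close>

text \<open>
  Distinct frequencies in the Dirichlet series of \<open>zeta(s) m^s\<close> are separated from that of its
  constant term by at least \<open>1 / (2 m)\<close>.
\<close>
lemma abs_ln_diff_ge:
  fixes m n :: nat
  assumes "m \<ge> 1" "n \<ge> 1" "m \<noteq> n"
  shows "1 \<le> 2 * real m * \<bar>ln (real m) - ln (real n)\<bar>"
proof (cases "n < m")
  case True
  have "ln (real n / real m) \<le> real n / real m - 1"
    using assms by (intro ln_le_minus_one) auto
  then have "ln (real m) - ln (real n) \<ge> (real m - real n) / real m"
    using assms by (simp add: ln_div diff_divide_distrib)
  moreover have "(real m - real n) / real m \<ge> 1 / real m"
    using True assms by (intro divide_right_mono) auto
  ultimately have "ln (real m) - ln (real n) \<ge> 1 / real m" by linarith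
  then have "real m * (1 / real m) \<le> real m * \<bar>ln (real m) - ln (real n)\<bar>"
    by (intro mult_left_mono) auto
  then show ?thesis using assms by simp
next
  case False
  then have mn: "m + 1 \<le> n" using assms by simp
  have "ln (real m / real (m + 1)) \<le> real m / real (m + 1) - 1"
    using assms by (intro ln_le_minus_one) auto
  then have "ln (real (m + 1)) - ln (real m) \<ge> 1 - real m / real (m + 1)"
    using assms by (simp add: ln_div)
  also have "1 - real m / real (m + 1) = 1 / real (m + 1)" by (simp add: field_simps)
  finally have "ln (real (m + 1)) - ln (real m) \<ge> 1 / real (m + 1)" .
  moreover have "ln (real (m + 1)) \<le> ln (real n)" using mn by (subst ln_le_cancel_iff) auto
  ultimately have *: "\<bar>ln (real m) - ln (real n)\<bar> \<ge> 1 / real (m + 1)" by linarith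
  have "1 \<le> 2 * real m * (1 / real (m + 1))" using assms by (simp add: field_simps)
  also have "\<dots> \<le> 2 * real m * \<bar>ln (real m) - ln (real n)\<bar>"
    using * by (intro mult_left_mono) auto
  finally show ?thesis .
qed

text \<open>
  Integrating \<open>zeta(s) m^s = \<Sum> (m/n)^s\<close> termwise, the term \<open>n = m\<close> contributes \<open>s\<close>
  and every other one contributes \<open>(m/n)^s / log (m/n)\<close>, whose denominator is at least \<open>1 / (2 m)\<close> in modulus. So
  on the line \<open>Re s = 2\<close> the primitive differs from \<open>s\<close> by \<open>O(m^3)\<close> only.
\<close>
lemma zeta_shifted_primitive:
  obtains K where "K > 0"
    "\<And>m::nat. m \<ge> 1 \<Longrightarrow> \<exists>P. (\<forall>s. Re s > 1 \<longrightarrow> (P has_field_derivative zeta s * of_nat m powr s) (at s)) \<and>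
        (\<forall>s. Re s = 2 \<longrightarrow> norm (P s - s) \<le> K * real m ^ 3)"
proof -
  define S where "S = (\<Sum>n. real (Suc n) powr (- 2))"
  have S: "summable (\<lambda>n. real (Suc n) powr (- 2))"
    using summable_real_powr_iff[of "-2"] by (subst summable_Suc_iff) simp
  show ?thesis
  proof (rule that[of "2 * S + 1"])
    have S0: "S \<ge> 0" unfolding S_def by (intro suminf_nonneg S) simp
    then show "2 * S + 1 > 0" by simp
    fix m :: nat assume m: "m \<ge> 1"
    \<comment> \<open>the coefficient of \<open>(n + 1)^(-s)\<close> in the primitive after splitting off the factor \<open>m^s\<close>\<close>
    define c where "c = (\<lambda>n. if Suc n = m then 0 else 1 / (ln (real m) - ln (real (Suc n))))"
    have c: "\<bar>c n\<bar> \<le> 2 * real m" for n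
    proof (cases "Suc n = m")
      case False
      then show ?thesis using abs_ln_diff_ge[of m "Suc n"] m
        by (simp add: c_def divide_simps del: of_nat_Suc)
    qed (simp add: c_def)
    define u where "u = (\<lambda>n s. of_real (c n) * (of_nat (Suc n) powr (- s)) :: complex)"
    define U where "U = (\<lambda>s. \<Sum>n. u n s)"
    have hol: "u n holomorphic_on {s. Re s > 1}" for n
      unfolding u_def by (intro holomorphic_intros) (auto simp del: of_nat_Suc)
    have norm_u: "norm (u n s) \<le> 2 * real m * real (Suc n) powr (- Re s)" for n s
      unfolding u_def norm_mult norm_nat_powr using c[of n] by (intro mult_mono) auto
    then have bound: "norm (u n s) \<le> norm (of_real (2 * real m) :: complex) * real (Suc n) powr (-(1 + (Re s - 1)))" for n s
      by simp
    note ser = holomorphic_on_series_moderate[of u, OF hol moderate_growth_const bound]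
    have du: "deriv (u n) s = - of_real (ln (real (Suc n))) * u n s" for n s
    proof (rule DERIV_imp_deriv)
      have "u n = (\<lambda>s. of_real (c n) * exp (- s * of_real (ln (real (Suc n)))))"
        by (auto simp: u_def powr_def Ln_of_nat simp del: of_nat_Suc)
      then show "(u n has_field_derivative - of_real (ln (real (Suc n))) * u n s) (at s)"
        by (auto intro!: derivative_eq_intros simp del: of_nat_Suc)
    qed
    define P where "P = (\<lambda>s. s + of_nat m powr s * U s)"
    show "\<exists>P. (\<forall>s. Re s > 1 \<longrightarrow> (P has_field_derivative zeta s * of_nat m powr s) (at s)) \<and>
        (\<forall>s. Re s = 2 \<longrightarrow> norm (P s - s) \<le> (2 * S + 1) * real m ^ 3)"
    proof (intro exI[of _ P] conjI allI impI)
      fix s :: complex assume s: "Re s > 1"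
      have dU: "(U has_field_derivative deriv U s) (at s)"
        using ser(1) s unfolding U_def
        by (intro holomorphic_derivI[of _ "{s. Re s > 1}"] open_halfspace_Re_gt) auto
      have "(\<lambda>n. of_real (ln (real m)) * u n s + deriv (u n) s) sums (of_real (ln (real m)) * U s + deriv U s)"
        unfolding U_def using ser(2,4)[OF s] by (intro sums_add sums_mult summable_sums) auto
      moreover have "of_real (ln (real m)) * u n s + deriv (u n) s =
          of_nat (Suc n) powr (- s) - (if n = m - 1 then of_nat m powr (- s) else 0)" for n
      proof (cases "Suc n = m")
        case True
        then show ?thesis by (auto simp: u_def du c_def simp del: of_nat_Suc)
      next
        case False
        then have "ln (real m) - ln (real (Suc n)) \<noteq> 0" using m by (simp del: of_nat_Suc)
        then have "(ln (real m) - ln (real (Suc n))) * c n = 1"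
          using False by (simp add: c_def del: of_nat_Suc)
        moreover have "of_real (ln (real m)) * u n s + deriv (u n) s =
            of_real ((ln (real m) - ln (real (Suc n))) * c n) * of_nat (Suc n) powr (- s)"
          unfolding du by (simp add: u_def algebra_simps del: of_nat_Suc)
        ultimately have "of_real (ln (real m)) * u n s + deriv (u n) s = of_nat (Suc n) powr (- s)"
          by simp
        then show ?thesis using False m by auto
      qed
      moreover have "(\<lambda>n. of_nat (Suc n) powr (- s) - (if n = m - 1 then of_nat m powr (- s) else 0)) sums
         (zeta s - of_nat m powr (- s))"
        by (intro sums_diff zeta_sums s sums_single[of "m - 1" "\<lambda>_. of_nat m powr (- s)"])
      ultimately have "of_real (ln (real m)) * U s + deriv U s = zeta s - of_nat m powr (- s)"
        by (simp add: sums_unique2)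
      moreover have "((\<lambda>s. of_nat m powr s) has_field_derivative of_real (ln (real m)) * of_nat m powr s) (at s)"
        using m by (auto intro!: derivative_eq_intros simp: Ln_of_nat)
      then have "(P has_field_derivative 1 + (of_real (ln (real m)) * of_nat m powr s * U s + deriv U s * of_nat m powr s)) (at s)"
        unfolding P_def by (intro DERIV_add DERIV_ident DERIV_mult dU)
      moreover have "of_nat m powr s * of_nat m powr (- s) = (1 :: complex)"
        using m by (simp flip: powr_add)
      then have "1 + (L * of_nat m powr s * X + Y * of_nat m powr s) = zeta s * of_nat m powr s"
        if "L * X + Y = zeta s - of_nat m powr (- s)" for L X Y :: complex
        using that by algebra
      ultimately show "(P has_field_derivative zeta s * of_nat m powr s) (at s)"
        by simp
    next
      fix s :: complex assume s: "Re s = 2"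
      have "norm (U s) \<le> (\<Sum>n. 2 * real m * real (Suc n) powr (- 2))"
        unfolding U_def using norm_u[of _ s] s by (intro norm_suminf_le summable_mult S) simp
      also have "\<dots> = 2 * real m * S" unfolding S_def by (intro suminf_mult S)
      finally have U: "norm (U s) \<le> 2 * real m * S" .
      have "norm (of_nat m powr s :: complex) = real m ^ 2"
        using norm_nat_powr[of "m - 1" s] m s by (simp del: of_nat_Suc add: powr_numeral)
      then have "norm (P s - s) = real m ^ 2 * norm (U s)" by (simp add: P_def norm_mult)
      also have "\<dots> \<le> real m ^ 2 * (2 * real m * S)" by (intro mult_left_mono U) auto
      also have "\<dots> = 2 * S * real m ^ 3" by (simp add: power2_eq_square power3_eq_cube)
      also have "\<dots> \<le> (2 * S + 1) * real m ^ 3" by (intro mult_right_mono) auto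
      finally show "norm (P s - s) \<le> (2 * S + 1) * real m ^ 3" .
    qed
  qed
qed

text \<open>
  The boundary terms in the contour argument have sizes \<open>m^3\<close> and \<open>m^2 T^(1/40)\<close>; with \<open>m\<close> about \<open>T^(1/10)\<close>
  both are below the length \<open>T^(2/5)\<close> of the window.
\<close>
lemma boundary_terms_below_window:
  fixes K D :: real assumes "K > 0" "D > 0"
  shows "eventually (\<lambda>T::real. 16 * K * T powr (3/10) + 40 * D * T powr (9/40) < (T powr (2/5) - 10) / 2) at_top"
  using assms by real_asymp

lemma left_side_factor_small:
  fixes D :: real assumes "D > 0"
  shows "eventually (\<lambda>T::real. 2 * D * T powr (-1/40) \<le> 1 / 2) at_top"
  using assms by real_asymp

text \<open>
  With \<open>m\<close> about \<open>T^(1/10)\<close> a primitive of \<open>zeta(s) m^s\<close> is compared along the sides of a rectangle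
  with \<open>-1/2 \<le> Re s \<le> 2\<close> whose height is nearly the length of the window. If there were no zero, then
  the right side would contribute its height up to \<open>O(m^3)\<close>, while the left side would contribute at most half its
  height, since there \<open>zeta(s) m^s\<close> is \<open>O(T^(1/40) m^(-1/2))\<close>, and the horizontal sides are negligible. The
  window is shrunk by 5 at both ends to leave room for the zero-free discs.
\<close>
lemma zeta_zero_in_short_window:
  "eventually (\<lambda>T::real. \<exists>s. zeta s = 0 \<and> T < Im s \<and> Im s < T + T powr (2/5)) at_top"
proof -
  obtain D where D: "D \<ge> 1"
    "\<And>t s. t \<ge> 10 \<Longrightarrow> (\<And>z. z \<in> ball (Complex 4 t) 5 \<Longrightarrow> zeta z \<noteq> 0) \<Longrightarrow>
        s \<in> cball (Complex 4 t) (9/2) \<Longrightarrow> norm (zeta s) \<le> D * t powr (1/40)"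
    using zeta_subpolynomial_of_zero_free[of "1/40"] by auto
  obtain K where K: "K > 0"
    "\<And>m::nat. m \<ge> 1 \<Longrightarrow> \<exists>P. (\<forall>s. Re s > 1 \<longrightarrow> (P has_field_derivative zeta s * of_nat m powr s) (at s)) \<and>
        (\<forall>s. Re s = 2 \<longrightarrow> norm (P s - s) \<le> K * real m ^ 3)"
    using zeta_shifted_primitive by metis
  have "eventually (\<lambda>T::real. T powr (2/5) \<ge> 20 \<and> T powr (2/5) \<le> T) at_top"
    by (intro eventually_conj; real_asymp)
  moreover have "eventually (\<lambda>T::real. T \<ge> 10) at_top" by (rule eventually_ge_at_top)
  moreover have "D > 0" using D(1) by simp
  note boundary_terms_below_window[OF K(1) this] left_side_factor_small[OF this]
  ultimately show ?thesis
  proof eventually_elim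
    case (elim T)
    define H where "H = T powr (2/5)"
    have T: "T \<ge> 10" and H: "H \<ge> 20" "H \<le> T" using elim by (auto simp: H_def)
    show ?case
    proof (rule ccontr)
      assume "\<not> ?case"
      then have free: "zeta s \<noteq> 0" if "T < Im s" "Im s < T + H" for s
        using that by (auto simp: H_def)
      \<comment> \<open>then \<open>m^(-1/2) T^(1/40)\<close> is of order \<open>T^(-1/40)\<close>, so the left side of the rectangle loses\<close>
      define m where "m = nat \<lceil>T powr (1/10)\<rceil>"
      have T10: "T powr (1/10) \<ge> 1" using T by (intro ge_one_powr_ge_zero) auto
      have m: "T powr (1/10) \<le> real m" "real m \<le> 2 * T powr (1/10)" "m \<ge> 1"
        using T10 by (auto simp: m_def) linarith+
      define B where "B = 2 * D * T powr (1/40)"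
      have B0: "B \<ge> 0" using D(1) by (simp add: B_def)
      define L U where "L = T + 5" and "U = T + H - 5"
      have LU: "U - L = H - 10" by (simp add: L_def U_def)
      have small: "norm (zeta s) \<le> B" if s: "-1/2 \<le> Re s" "Re s \<le> 2" "L \<le> Im s" "Im s \<le> U" for s
      proof -
        have "norm (zeta s) \<le> D * Im s powr (1/40)"
        proof (rule D(2))
          show "Im s \<ge> 10" using s T by (simp add: L_def)
          show "zeta z \<noteq> 0" if "z \<in> ball (Complex 4 (Im s)) 5" for z
            using that abs_Im_le_cmod[of "Complex 4 (Im s) - z"] s
            by (intro free) (auto simp: dist_norm L_def U_def)
          have "s - Complex 4 (Im s) = of_real (Re s - 4)" by (simp add: complex_eq_iff)
          then show "s \<in> cball (Complex 4 (Im s)) (9/2)"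
            using s by (simp add: dist_norm norm_minus_commute del: of_real_diff)
        qed
        also have "\<dots> \<le> D * (2 * T) powr (1/40)"
          using D(1) s T H by (intro mult_left_mono powr_mono2) (auto simp: L_def U_def)
        also have "\<dots> \<le> D * (2 * T powr (1/40))"
        proof -
          have "(2::real) powr (1/40) \<le> 2 powr 1" by (intro powr_mono) auto
          then show ?thesis using D(1) T by (simp add: powr_mult mult_right_mono)
        qed
        finally show ?thesis by (simp add: B_def)
      qed
      obtain P where P: "\<And>s. Re s > 1 \<Longrightarrow> (P has_field_derivative zeta s * of_nat m powr s) (at s)"
        "\<And>s. Re s = 2 \<Longrightarrow> norm (P s - s) \<le> K * real m ^ 3"
        using K(2)[OF m(3)] by blast
      have "(\<lambda>s. zeta s * of_nat m powr s) holomorphic_on {s. Im s > 0}"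
        using m(3) by (intro holomorphic_intros holomorphic_on_subset[OF zeta_holomorphic]) auto
      then obtain G where G: "\<And>s. Im s > 0 \<Longrightarrow> (G has_field_derivative zeta s * of_nat m powr s) (at s)"
        using holomorphic_convex_primitive'[of "{s. Im s > 0}" "\<lambda>s. zeta s * of_nat m powr s"]
        by (auto simp: convex_halfspace_Im_gt open_halfspace_Im_gt at_within_open[of _ "{s. Im s > 0}"])
      have nm: "norm (of_nat m powr s :: complex) = real m powr Re s" for s
        using norm_nat_powr[of "m - 1" s] m(3) by (simp del: of_nat_Suc)
      have pos: "L > 0" "U > 0" "L \<le> U" using T H by (auto simp: L_def U_def)
      define z1 z2 z3 z4 where "z1 = Complex 2 L" and "z2 = Complex 2 U"
        and "z3 = Complex (-1/2) U" and "z4 = Complex (-1/2) L"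
      have seg_vert: "closed_segment (Complex x L) (Complex x U) \<subseteq> {s. Re s = x \<and> L \<le> Im s \<and> Im s \<le> U}" for x
        using pos by (auto simp: closed_segment_same_Re closed_segment_eq_real_ivl)
      have seg_hor: "closed_segment (Complex 2 y) (Complex (-1/2) y) \<subseteq> {s. Im s = y \<and> -1/2 \<le> Re s \<and> Re s \<le> 2}" for y
        by (auto simp: closed_segment_same_Im closed_segment_eq_real_ivl)
      \<comment> \<open>the two primitives are not known to agree, but they differ by a constant where both are defined\<close>
      have right: "norm ((G z2 - P z2) - (G z1 - P z1)) \<le> 0 * norm (z2 - z1)"
      proof (rule field_differentiable_bound[where S = "closed_segment z1 z2" and f' = "\<lambda>_. 0"])
        show "((\<lambda>z. G z - P z) has_field_derivative 0) (at z within closed_segment z1 z2)"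
          if "z \<in> closed_segment z1 z2" for z
        proof -
          have z: "Re z = 2" "L \<le> Im z" using that seg_vert[of 2] by (auto simp: z1_def z2_def)
          have "((\<lambda>z. G z - P z) has_field_derivative (zeta z * of_nat m powr z - zeta z * of_nat m powr z)) (at z)"
            using z pos by (intro DERIV_diff G P) auto
          then show ?thesis by (auto intro: has_field_derivative_at_within)
        qed
      qed auto
      have hor: "norm (G (Complex 2 y) - G (Complex (-1/2) y)) \<le> (B * real m ^ 2) * (5/2)" if y: "L \<le> y" "y \<le> U" for y
      proof -
        have "norm (G (Complex 2 y) - G (Complex (-1/2) y)) \<le> (B * real m ^ 2) * norm (Complex 2 y - Complex (-1/2) y)"
        proof (rule field_differentiable_bound[where S = "closed_segment (Complex 2 y) (Complex (-1/2) y)" and f' = "\<lambda>z. zeta z * of_nat m powr z"])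
          fix z assume "z \<in> closed_segment (Complex 2 y) (Complex (-1/2) y)"
          then have z: "Im z = y" "-1/2 \<le> Re z" "Re z \<le> 2" using seg_hor[of y] by auto
          then show "(G has_field_derivative zeta z * of_nat m powr z) (at z within closed_segment (Complex 2 y) (Complex (-1/2) y))"
            using y pos by (auto intro: has_field_derivative_at_within[OF G])
          have "real m powr Re z \<le> real m powr 2" using z m(3) by (intro powr_mono) auto
          then have "real m powr Re z \<le> real m ^ 2" using m(3) by (simp add: powr_numeral)
          then show "norm (zeta z * of_nat m powr z) \<le> B * real m ^ 2"
            unfolding norm_mult nm using z y B0 by (intro mult_mono small) auto
        qed auto
        also have "Complex 2 y - Complex (-1/2) y = of_real (5/2)" by (simp add: complex_eq_iff)
        finally show ?thesis by simp
      qed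
      have left: "norm (G z4 - G z3) \<le> (B * real m powr (-1/2)) * norm (z4 - z3)"
      proof (rule field_differentiable_bound[where S = "closed_segment z4 z3" and f' = "\<lambda>z. zeta z * of_nat m powr z"])
        fix z assume "z \<in> closed_segment z4 z3"
        then have z: "Re z = -1/2" "L \<le> Im z" "Im z \<le> U" using seg_vert[of "-1/2"] by (auto simp: z3_def z4_def)
        then show "(G has_field_derivative zeta z * of_nat m powr z) (at z within closed_segment z4 z3)"
          using pos by (auto intro: has_field_derivative_at_within[OF G])
        show "norm (zeta z * of_nat m powr z) \<le> B * real m powr (-1/2)"
          unfolding norm_mult nm using z B0 by (intro mult_mono small) auto
      qed auto
      have "z4 - z3 = of_real (U - L) * (- \<i>)" "z2 - z1 = of_real (U - L) * \<i>"
        by (auto simp: z1_def z2_def z3_def z4_def complex_eq_iff)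
      then have len: "norm (z4 - z3) = U - L" "norm (z2 - z1) = U - L"
        using pos by (simp_all add: norm_mult del: of_real_diff)
      have triangle: "norm x \<le> norm a + norm b + norm c + norm d + norm e + norm f"
        if "x = a + b + c - d + e - f" for x a b c d e f :: complex
        unfolding that using norm_triangle_ineq[of a b] norm_triangle_ineq[of "a + b" c]
          norm_triangle_ineq4[of "a + b + c" d] norm_triangle_ineq[of "a + b + c - d" e]
          norm_triangle_ineq4[of "a + b + c - d + e" f] by linarith
      have "norm (z2 - z1) \<le> norm (G z2 - G z3) + norm (G z3 - G z4) + norm (G z4 - G z1)
          + norm (P z2 - z2) + norm (P z1 - z1) + norm ((G z2 - P z2) - (G z1 - P z1))"
        by (rule triangle) simp
      then have main: "U - L \<le> 2 * (B * real m ^ 2 * (5/2)) + B * real m powr (-1/2) * (U - L) + 2 * (K * real m ^ 3)"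
        using right hor[of L] hor[of U] left P(2)[of z1] P(2)[of z2] pos unfolding len
        by (simp add: z1_def z2_def z3_def z4_def norm_minus_commute)
      have "B * real m powr (-1/2) \<le> 1/2"
      proof -
        have "real m powr (-1/2) \<le> (T powr (1/10)) powr (-1/2)"
          using m T10 by (intro powr_mono2') auto
        also have "\<dots> = T powr (-1/20)" by (simp add: powr_powr)
        finally have "B * real m powr (-1/2) \<le> 2 * D * (T powr (1/40) * T powr (-1/20))"
          using D(1) by (simp add: B_def mult_left_mono)
        also have "T powr (1/40) * T powr (-1/20) = T powr (-1/40)" by (simp flip: powr_add)
        finally show ?thesis using elim(4) by linarith
      qed
      then have b1: "B * real m powr (-1/2) * (U - L) \<le> (1/2) * (U - L)"
        using pos by (intro mult_right_mono) auto
      have b2: "B * real m ^ 2 \<le> 8 * D * T powr (9/40)"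
      proof -
        have "B * real m ^ 2 \<le> B * (2 * T powr (1/10)) ^ 2"
          using m B0 by (intro mult_left_mono power_mono) auto
        also have "(2 * T powr (1/10)) ^ 2 = 4 * T powr (1/5)"
          using T by (simp add: power_mult_distrib powr_power)
        also have "B * (4 * T powr (1/5)) = 8 * D * (T powr (1/40) * T powr (1/5))"
          by (simp add: B_def)
        also have "T powr (1/40) * T powr (1/5) = T powr (9/40)" by (simp flip: powr_add)
        finally show ?thesis .
      qed
      have b3: "K * real m ^ 3 \<le> 8 * K * T powr (3/10)"
      proof -
        have "K * real m ^ 3 \<le> K * (2 * T powr (1/10)) ^ 3"
          using m K(1) by (intro mult_left_mono power_mono) auto
        also have "(2 * T powr (1/10)) ^ 3 = 8 * T powr (3/10)"
          using T by (simp add: power_mult_distrib powr_power)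
        finally show ?thesis by (simp add: mult_ac)
      qed
      have arith: "x / 2 \<le> 5 * b + 2 * c" if "x \<le> 2 * (a * (5/2)) + y + 2 * c'" "y \<le> (1/2) * x" "a \<le> b" "c' \<le> c"
        for x y a b c c' :: real
        using that by linarith
      have "(H - 10) / 2 \<le> 5 * (8 * D * T powr (9/40)) + 2 * (8 * K * T powr (3/10))"
        using arith[OF main b1 b2 b3] unfolding LU .
      also have "\<dots> = 16 * K * T powr (3/10) + 40 * D * T powr (9/40)" by simp
      also have "\<dots> < (H - 10) / 2" using elim(3) unfolding H_def .
      finally show False by simp
    qed
  qed
qed

section \<open>Counting the ordinates\<close>

text \<open>
  Infinitely many zeros on a compact segment avoiding the pole would accumulate and force zeta to
  vanish identically. Finiteness ensures that the sums over ordinates are genuine sums, not the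
  default value 0.
\<close>
lemma finite_ordinates: "finite {\<gamma>. \<gamma> \<in> zeta_ordinates \<and> 0 < \<gamma> \<and> \<gamma> \<le> T}"
proof (rule ccontr)
  define A where "A = {\<gamma>. \<gamma> \<in> zeta_ordinates \<and> 0 < \<gamma> \<and> \<gamma> \<le> T}"
  define K where "K = (\<lambda>\<gamma>. Complex (1/2) \<gamma>) ` {0..T}"
  assume "infinite {\<gamma>. \<gamma> \<in> zeta_ordinates \<and> 0 < \<gamma> \<and> \<gamma> \<le> T}"
  then have "infinite A" by (simp add: A_def)
  then have inf: "infinite ((\<lambda>\<gamma>. Complex (1/2) \<gamma>) ` A)"
    by (simp add: finite_image_iff inj_on_def)
  have "(\<lambda>\<gamma>. Complex (1/2) \<gamma>) = (\<lambda>\<gamma>. 1/2 + \<i> * of_real \<gamma>)"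
    by (auto simp: complex_eq_iff)
  then have "compact K" unfolding K_def
    by (intro compact_continuous_image) (auto intro!: continuous_intros)
  moreover have "(\<lambda>\<gamma>. Complex (1/2) \<gamma>) ` A \<subseteq> K" by (auto simp: A_def K_def)
  ultimately obtain \<xi> where \<xi>: "\<xi> \<in> K" "\<xi> islimpt ((\<lambda>\<gamma>. Complex (1/2) \<gamma>) ` A)"
    using inf unfolding compact_eq_Bolzano_Weierstrass by blast
  have "zeta 3 = 0"
  proof (rule analytic_continuation[OF zeta_holomorphic _ _ _ _ \<xi>(2)])
    show "connected (- {1 :: complex})" by (rule connected_punctured_universe) simp
    show "(\<lambda>\<gamma>. Complex (1/2) \<gamma>) ` A \<subseteq> - {1}" by (auto simp: complex_eq_iff)
    show "\<xi> \<in> - {1}" using \<xi>(1) by (auto simp: K_def complex_eq_iff)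
    show "zeta z = 0" if "z \<in> (\<lambda>\<gamma>. Complex (1/2) \<gamma>) ` A" for z
      using that by (auto simp: A_def zeta_ordinates_def nontrivial_zeros_def)
  qed auto
  then show False using zeta_near_one[of 3] by simp
qed

text \<open>
  As zeta is not locally zero, its order at a zero is a true positive multiplicity.
\<close>
lemma ordinate_mult_ge_1:
  assumes "\<gamma> \<in> zeta_ordinates"
  shows "ordinate_mult \<gamma> \<ge> 1"
proof -
  define z where "z = Complex (1/2) \<gamma>"
  have z: "zeta z = 0" "z \<noteq> 1"
    using assms by (auto simp: z_def zeta_ordinates_def nontrivial_zeros_def)
  have conn: "connected (- {1 :: complex})" by (rule connected_punctured_universe) simp
  have "zeta 3 \<noteq> 0" using zeta_near_one[of 3] by auto
  then obtain r where r: "r > 0" "ball z r \<subseteq> - {1}" "\<And>w. w \<in> ball z r - {z} \<Longrightarrow> zeta w \<noteq> 0"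
    using isolated_zeros[OF zeta_holomorphic _ conn, of z 3] z by auto
  have "eventually (\<lambda>w. w \<in> ball z r - {z}) (at z)"
    using r(1) by (intro eventually_at_in_open) auto
  then have "eventually (\<lambda>w. zeta w \<noteq> 0) (at z)" by eventually_elim (use r(3) in auto)
  then have "frequently (\<lambda>w. zeta w \<noteq> 0) (at z)" by (intro eventually_frequently) auto
  then have "zorder zeta z > 0"
    using zorder_pos_iff[OF zeta_holomorphic, of z] z by auto
  then show ?thesis by (simp add: ordinate_mult_def z_def)
qed

text \<open>
  The interval from \<open>T/2\<close> to \<open>T\<close> contains about \<open>T^(3/5) / 2\<close> disjoint windows of length \<open>T^(2/5)\<close>, each
  containing the imaginary part of a zero, which RH places on the critical line.
\<close>
lemma zero_count_lower_bound:
  assumes RH: riemann_hypothesis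
  shows "eventually (\<lambda>T. T powr (3/5) / 4 \<le> zero_count T) at_top"
proof -
  obtain T0 where T0: "\<And>T. T \<ge> T0 \<Longrightarrow> \<exists>s. zeta s = 0 \<and> T < Im s \<and> Im s < T + T powr (2/5)"
    using zeta_zero_in_short_window unfolding eventually_at_top_linorder by blast
  have "eventually (\<lambda>T::real. T powr (3/5) / 4 \<ge> 1) at_top" by real_asymp
  moreover have "eventually (\<lambda>T::real. T \<ge> max 1 (2 * T0)) at_top" by (rule eventually_ge_at_top)
  ultimately show ?thesis
  proof eventually_elim
    case (elim T)
    define H where "H = T powr (2/5)"
    have T: "T \<ge> 1" "T / 2 \<ge> T0" and H: "H > 0" using elim by (auto simp: H_def)
    define n where "n = nat \<lfloor>T / (2 * H)\<rfloor>"
    have "T / (2 * H) = T powr (3/5) / 2"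
    proof -
      have "T powr (3/5) * H = T" unfolding H_def using T by (simp flip: powr_add)
      then show ?thesis using H by (simp add: field_simps)
    qed
    then have n_ge: "real n \<ge> T powr (3/5) / 4" and n_le: "real n \<le> T / (2 * H)"
      using elim(1) by (auto simp: n_def) linarith+
    have "\<exists>\<gamma>. \<gamma> \<in> zeta_ordinates \<and> T / 2 + real j * H < \<gamma> \<and> \<gamma> < T / 2 + real (Suc j) * H" if j: "j < n" for j
    proof -
      define t where "t = T / 2 + real j * H"
      have jH: "real j * H \<ge> 0" using H by simp
      have "real j * H \<le> real n * H" using j H by (intro mult_right_mono) auto
      also have "\<dots> \<le> T / 2" using n_le H by (simp add: field_simps)
      finally have t: "t \<le> T" "t \<ge> T0" "t > 0" using T jH by (auto simp: t_def)
      then obtain s where s: "zeta s = 0" "t < Im s" "Im s < t + t powr (2/5)"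
        using T0 by blast
      have "t powr (2/5) \<le> H" using t unfolding H_def by (intro powr_mono2) auto
      moreover have "s \<in> nontrivial_zeros"
        using s t by (auto simp: nontrivial_zeros_def)
      moreover from this have "s = Complex (1/2) (Im s)"
        using RH by (auto simp: riemann_hypothesis_def complex_eq_iff)
      ultimately show ?thesis
        using s by (intro exI[of _ "Im s"]) (auto simp: zeta_ordinates_def t_def algebra_simps)
    qed
    then obtain g where g: "\<And>j. j < n \<Longrightarrow> g j \<in> zeta_ordinates \<and> T / 2 + real j * H < g j \<and> g j < T / 2 + real (Suc j) * H"
      by metis
    define A where "A = {\<gamma>. \<gamma> \<in> zeta_ordinates \<and> 0 < \<gamma> \<and> \<gamma> \<le> T}"
    have sub: "g ` {..<n} \<subseteq> A"
    proof safe
      fix j assume j: "j < n"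
      have "real (Suc j) * H \<le> real n * H" using j H by (intro mult_right_mono) auto
      also have "\<dots> \<le> T / 2" using n_le H by (simp add: field_simps)
      finally have "g j \<le> T" using g[OF j] by linarith
      moreover have "real j * H \<ge> 0" using H by simp
      then have "0 < g j" using g[OF j] T by linarith
      ultimately show "g j \<in> A" using g[OF j] by (simp add: A_def)
    qed
    have "inj_on g {..<n}"
    proof (rule strict_mono_on_imp_inj_on, rule strict_mono_onI)
      fix i j assume ij: "i \<in> {..<n}" "j \<in> {..<n}" "i < j"
      have "real (Suc i) * H \<le> real j * H" using ij H by (intro mult_right_mono) auto
      then show "g i < g j" using g[of i] g[of j] ij by auto
    qed
    then have "real n = (\<Sum>\<gamma>\<in>g ` {..<n}. 1)" by (simp add: card_image)
    also have "\<dots> \<le> (\<Sum>\<gamma>\<in>A. 1)"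
      using sub finite_ordinates[of T] by (intro sum_mono2) (auto simp: A_def)
    also have "\<dots> \<le> (\<Sum>\<gamma>\<in>A. real (ordinate_mult \<gamma>))"
      by (intro sum_mono) (use ordinate_mult_ge_1 in \<open>force simp: A_def\<close>)
    also have "\<dots> = zero_count T" by (simp add: zero_count_def A_def)
    finally show ?case using n_ge by linarith
  qed
qed

section \<open>Trigonometric majorants of arcs\<close>

text \<open>
  In terms of the angle, rather than of the point on the circle, a product of monomials is again a
  monomial, with the frequencies added.
\<close>
inductive trig_poly :: "(real \<Rightarrow> complex) \<Rightarrow> bool" where
  monomial: "trig_poly (\<lambda>\<theta>. c * cis (2 * pi * of_int k * \<theta>))"
| add: "trig_poly p \<Longrightarrow> trig_poly q \<Longrightarrow> trig_poly (\<lambda>\<theta>. p \<theta> + q \<theta>)"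

lemma trig_poly_mult:
  assumes "trig_poly p" "trig_poly q"
  shows "trig_poly (\<lambda>\<theta>. p \<theta> * q \<theta>)"
  using assms
proof (induction p)
  case (monomial c k)
  from \<open>trig_poly q\<close> show ?case
  proof (induction q)
    case (monomial d l)
    have "(\<lambda>\<theta>. c * cis (2 * pi * of_int k * \<theta>) * (d * cis (2 * pi * of_int l * \<theta>))) =
        (\<lambda>\<theta>. (c * d) * cis (2 * pi * of_int (k + l) * \<theta>))"
      by (simp add: fun_eq_iff cis_mult distrib_left distrib_right mult_ac)
    then show ?case using trig_poly.monomial[of "c * d" "k + l"] by simp
  next
    case (add p q)
    then show ?case using trig_poly.add by (simp add: distrib_left)
  qed
next
  case (add p q)
  then show ?case using trig_poly.add by (simp add: distrib_right)
qed

lemma trig_poly_const: "trig_poly (\<lambda>\<theta>. c)"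
  using trig_poly.monomial[of c 0] by simp

text \<open>
  This makes the polynomials of the Stone-Weierstrass theorem on the unit circle accessible to
  exponential sums.
\<close>
lemma trig_poly_real_polynomial_function:
  assumes "real_polynomial_function q"
  shows "trig_poly (\<lambda>\<theta>. of_real (q (cis (2 * pi * \<theta>))))"
  using assms
proof induction
  case (linear f)
  have "f (cis t) = cos t * f 1 + sin t * f \<i>" for t
  proof -
    have "cis t = cos t *\<^sub>R 1 + sin t *\<^sub>R \<i>" by (simp add: complex_eq_iff)
    then show ?thesis
      using linear by (simp add: bounded_linear.linear linear_add linear_scale)
  qed
  then have "of_real (f (cis t)) = ((of_real (f 1) + of_real (f \<i>) / \<i>) / 2) * cis t + ((of_real (f 1) - of_real (f \<i>) / \<i>) / 2) * cis (- t)" for t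
    by (simp add: complex_eq_iff field_simps)
  then have eq: "(\<lambda>\<theta>. complex_of_real (f (cis (2 * pi * \<theta>)))) =
      (\<lambda>\<theta>. ((of_real (f 1) + of_real (f \<i>) / \<i>) / 2) * cis (2 * pi * of_int 1 * \<theta>) + ((of_real (f 1) - of_real (f \<i>) / \<i>) / 2) * cis (2 * pi * of_int (-1) * \<theta>))"
    by simp
  show ?case unfolding eq by (intro trig_poly.add trig_poly.monomial)
next
  case (const c)
  show ?case by (rule trig_poly_const)
next
  case (add f g)
  then show ?case using trig_poly.add by simp
next
  case (mult f g)
  then show ?case using trig_poly_mult by simp
qed

lemma cis_has_integral_0:
  assumes "k \<noteq> (0::int)"
  shows "((\<lambda>\<theta>. c * cis (2 * pi * of_int k * \<theta>)) has_integral 0) {0..1}"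
proof -
  define F where "F = (\<lambda>\<theta>. c / (2 * pi * of_int k * \<i>) * cis (2 * pi * of_int k * \<theta>))"
  have "((\<lambda>\<theta>. c * cis (2 * pi * of_int k * \<theta>)) has_integral (F 1 - F 0)) {0..1}"
  proof (rule fundamental_theorem_of_calculus)
    fix x :: real
    have "((\<lambda>\<theta>. cis (2 * pi * of_int k * \<theta>)) has_vector_derivative (2 * pi * of_int k) *\<^sub>R (\<i> * cis (2 * pi * of_int k * x))) (at x within {0..1})"
      using has_derivative_cis[OF has_derivative_mult_right[OF has_derivative_ident], of "2 * pi * of_int k" x "{0..1}"]
      by (simp add: has_vector_derivative_def mult.commute)
    from has_vector_derivative_mult_right[OF this, of "c / (2 * pi * of_int k * \<i>)"]
    show "(F has_vector_derivative c * cis (2 * pi * of_int k * x)) (at x within {0..1})"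
      using assms by (simp add: F_def scaleR_conv_of_real field_simps)
  qed simp
  moreover have "F 1 = F 0" using cis_multiple_2pi[of "of_int k"] by (simp add: F_def mult_ac)
  ultimately show ?thesis by simp
qed

text \<open>
  The tent functions \<open>max 0 (1 - n dist (z, K))\<close> around the arc \<open>K\<close> converge to its indicator, so their
  integrals converge to \<open>\<beta> - \<alpha>\<close>. Distances are taken on the circle because the parameters 0 and 1 give the same point:
  an arc that ends there has to be majorized on both sides of it.
\<close>
lemma arc_majorant:
  assumes ab: "0 \<le> \<alpha>" "\<alpha> \<le> \<beta>" "\<beta> \<le> 1" and e: "\<epsilon> > 0"
  obtains g :: "complex \<Rightarrow> real" where "continuous_on UNIV g" "\<And>z. g z \<ge> 0"
    "\<And>\<theta>. \<theta> \<in> {\<alpha>..\<beta>} \<Longrightarrow> g (cis (2 * pi * \<theta>)) \<ge> 1"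
    "integral {0..1} (\<lambda>\<theta>. g (cis (2 * pi * \<theta>))) < \<beta> - \<alpha> + \<epsilon>"
proof -
  define K where "K = (\<lambda>\<theta>. cis (2 * pi * \<theta>)) ` {\<alpha>..\<beta>}"
  have contcis: "continuous_on A (\<lambda>\<theta>. cis (2 * pi * \<theta>))" for A
    unfolding cis_conv_exp by (intro continuous_intros)
  have "compact K" unfolding K_def by (intro compact_continuous_image contcis) auto
  then have clK: "closed K" by (rule compact_imp_closed)
  have neK: "K \<noteq> {}" using ab by (simp add: K_def)
  define G where "G = (\<lambda>(n::nat) z. max 0 (1 - real n * infdist z K))"
  have contG: "continuous_on A (G n)" for n A
    unfolding G_def by (intro continuous_intros)
  have lim: "(\<lambda>n. G n z) \<longlonglongrightarrow> indicator K z" for z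
  proof (cases "z \<in> K")
    case True
    then show ?thesis by (simp add: G_def)
  next
    case False
    then have pos: "infdist z K > 0"
      using clK neK in_closed_iff_infdist_zero[of K z] infdist_nonneg[of z K] by auto
    obtain N where N: "real N > 1 / infdist z K" using reals_Archimedean2 by blast
    have "G n z = 0" if "n \<ge> N" for n
    proof -
      have "1 / infdist z K \<le> real n" using N that by simp
      then have "1 \<le> real n * infdist z K" using pos by (simp add: field_simps)
      then show ?thesis by (simp add: G_def)
    qed
    then have "eventually (\<lambda>n. G n z = 0) sequentially" by (auto simp: eventually_sequentially)
    then show ?thesis using False by (simp add: tendsto_eventually)
  qed
  have conv: "(\<lambda>n. integral {0..1} (\<lambda>\<theta>. G n (cis (2 * pi * \<theta>)))) \<longlonglongrightarrow> integral {0..1} (\<lambda>\<theta>. indicator K (cis (2 * pi * \<theta>)))"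
  proof (rule dominated_convergence(2)[where h = "\<lambda>_. 1"])
    show "(\<lambda>\<theta>. G n (cis (2 * pi * \<theta>))) integrable_on {0..1}" for n
      by (intro integrable_continuous_interval continuous_on_compose2[OF contG contcis]) auto
    show "norm (G n (cis (2 * pi * \<theta>))) \<le> 1" for n \<theta>
      using infdist_nonneg[of "cis (2 * pi * \<theta>)" K] by (simp add: G_def)
  qed (use lim in auto)
  have "((\<lambda>\<theta>. indicator K (cis (2 * pi * \<theta>)) :: real) has_integral (\<beta> - \<alpha>)) {0..1}"
  \<comment> \<open>the endpoints 0 and 1 are excluded because both map to the point 1, which may lie on the arc through just one of them\<close>
  proof (rule has_integral_spike_finite[where S = "{0,1}" and f = "\<lambda>\<theta>. if \<theta> \<in> {\<alpha>..\<beta>} then 1 else 0"])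
    have "((\<lambda>\<theta>. 1 :: real) has_integral (\<beta> - \<alpha>)) {\<alpha>..\<beta>}"
      using has_integral_const_real[of "1::real" \<alpha> \<beta>] ab by simp
    then show "((\<lambda>\<theta>. if \<theta> \<in> {\<alpha>..\<beta>} then 1 else 0 :: real) has_integral (\<beta> - \<alpha>)) {0..1}"
      using ab by (subst has_integral_restrict) auto
    fix \<theta> :: real assume \<theta>: "\<theta> \<in> {0..1} - {0,1}"
    have "\<theta> \<in> {\<alpha>..\<beta>}" if mem: "cis (2 * pi * \<theta>) \<in> K"
    proof -
      obtain \<phi> where \<phi>: "\<phi> \<in> {\<alpha>..\<beta>}" "cis (2 * pi * \<theta>) = cis (2 * pi * \<phi>)"
        using mem unfolding K_def by blast
      then have "sin (2 * pi * \<theta>) = sin (2 * pi * \<phi>) \<and> cos (2 * pi * \<theta>) = cos (2 * pi * \<phi>)"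
        by (simp add: complex_eq_iff)
      then obtain n :: int where "2 * pi * \<theta> = 2 * pi * \<phi> + 2 * pi * n"
        using sin_cos_eq_iff by metis
      then have "2 * pi * \<theta> = 2 * pi * (\<phi> + n)" by (simp add: distrib_left)
      then have n: "\<theta> = \<phi> + n" by simp
      then have "\<bar>real_of_int n\<bar> < 1" using \<theta> \<phi>(1) ab by auto
      then have "n = 0" by simp
      then show ?thesis using n \<phi>(1) by simp
    qed
    then have "cis (2 * pi * \<theta>) \<in> K \<longleftrightarrow> \<theta> \<in> {\<alpha>..\<beta>}" unfolding K_def by blast
    then show "indicator K (cis (2 * pi * \<theta>)) = (if \<theta> \<in> {\<alpha>..\<beta>} then 1 else 0 :: real)"
      by (simp add: indicator_def del: atLeastAtMost_iff)
  qed simp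
  then have "integral {0..1} (\<lambda>\<theta>. indicator K (cis (2 * pi * \<theta>)) :: real) = \<beta> - \<alpha>"
    by (rule integral_unique)
  then have "(\<lambda>n. integral {0..1} (\<lambda>\<theta>. G n (cis (2 * pi * \<theta>)))) \<longlonglongrightarrow> \<beta> - \<alpha>"
    using conv by simp
  then have "eventually (\<lambda>n. integral {0..1} (\<lambda>\<theta>. G n (cis (2 * pi * \<theta>))) < \<beta> - \<alpha> + \<epsilon>) sequentially"
    by (rule order_tendstoD(2)) (use e in simp)
  then obtain n where "integral {0..1} (\<lambda>\<theta>. G n (cis (2 * pi * \<theta>))) < \<beta> - \<alpha> + \<epsilon>"
    by (auto simp: eventually_sequentially)
  moreover have "G n (cis (2 * pi * \<theta>)) \<ge> 1" if "\<theta> \<in> {\<alpha>..\<beta>}" for \<theta>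
  proof -
    have "cis (2 * pi * \<theta>) \<in> K" using that by (auto simp: K_def)
    then show ?thesis by (simp add: G_def)
  qed
  ultimately show ?thesis
    using contG by (intro that[of "G n"]) (auto simp: G_def)
qed

text \<open>
  A continuous majorant is approximated uniformly by a polynomial on the circle and then lifted by
  the error of approximation.
\<close>
lemma arc_trig_poly_majorant:
  assumes ab: "0 \<le> \<alpha>" "\<alpha> \<le> \<beta>" "\<beta> \<le> 1" and e: "\<epsilon> > 0"
  obtains p where "trig_poly (\<lambda>\<theta>. of_real (p \<theta>))"
    "\<And>\<theta>. indicator {\<alpha>..\<beta>} (frac \<theta>) \<le> p \<theta>"
    "p integrable_on {0..1}" "integral {0..1} p \<le> \<beta> - \<alpha> + \<epsilon>"
proof -
  obtain g :: "complex \<Rightarrow> real" where g: "continuous_on UNIV g" "\<And>z. g z \<ge> 0"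
    "\<And>\<theta>. \<theta> \<in> {\<alpha>..\<beta>} \<Longrightarrow> g (cis (2 * pi * \<theta>)) \<ge> 1"
    "integral {0..1} (\<lambda>\<theta>. g (cis (2 * pi * \<theta>))) < \<beta> - \<alpha> + \<epsilon> / 3"
    using arc_majorant[OF ab, of "\<epsilon> / 3"] e by auto
  obtain q where q: "real_polynomial_function q" "\<And>z. z \<in> sphere 0 1 \<Longrightarrow> \<bar>g z - q z\<bar> < \<epsilon> / 3"
  proof (rule Stone_Weierstrass_real_polynomial_function)
    show "compact (sphere (0::complex) 1)" by simp
    show "continuous_on (sphere 0 1) g" using g(1) continuous_on_subset by blast
    show "0 < \<epsilon> / 3" using e by simp
  qed (use that in blast)
  define p where "p = (\<lambda>\<theta>. q (cis (2 * pi * \<theta>)) + \<epsilon> / 3)"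
  have gq: "\<bar>g (cis t) - q (cis t)\<bar> < \<epsilon> / 3" for t by (intro q(2)) simp
  have contcis: "continuous_on A (\<lambda>\<theta>. cis (2 * pi * \<theta>))" for A
    unfolding cis_conv_exp by (intro continuous_intros)
  have contq: "continuous_on UNIV q"
    using q(1) continuous_on_polymonial_function real_polynomial_function_eq by blast
  have "continuous_on {0..1} p" unfolding p_def
    by (rule continuous_on_add[OF continuous_on_compose2[OF contq contcis] continuous_on_const]) simp
  then have int: "p integrable_on {0..1}" by (rule integrable_continuous_interval)
  have "continuous_on {0..1} (\<lambda>\<theta>. g (cis (2 * pi * \<theta>)))"
    by (rule continuous_on_compose2[OF g(1) contcis]) simp
  then have intg: "(\<lambda>\<theta>. g (cis (2 * pi * \<theta>))) integrable_on {0..1}"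
    by (rule integrable_continuous_interval)
  show ?thesis
  proof (rule that[of p])
    show "trig_poly (\<lambda>\<theta>. of_real (p \<theta>))"
      using trig_poly.add[OF trig_poly_real_polynomial_function[OF q(1)] trig_poly_const[of "of_real (\<epsilon> / 3)"]]
      by (simp add: p_def)
    fix \<theta> :: real
    have "cis (2 * pi * \<theta>) = cis (2 * pi * frac \<theta> + 2 * pi * of_int \<lfloor>\<theta>\<rfloor>)"
      by (simp add: frac_def algebra_simps)
    also have "\<dots> = cis (2 * pi * frac \<theta>) * cis (2 * pi * of_int \<lfloor>\<theta>\<rfloor>)"
      by (rule cis_mult[symmetric])
    also have "cis (2 * pi * of_int \<lfloor>\<theta>\<rfloor>) = 1" by (rule cis_multiple_2pi) simp
    finally have cf: "cis (2 * pi * \<theta>) = cis (2 * pi * frac \<theta>)" by simp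
    have "p \<theta> = q (cis (2 * pi * frac \<theta>)) + \<epsilon> / 3"
      unfolding p_def cf ..
    then have "g (cis (2 * pi * frac \<theta>)) \<le> p \<theta>"
      using gq[of "2 * pi * frac \<theta>"] by linarith
    moreover have "indicator {\<alpha>..\<beta>} (frac \<theta>) \<le> g (cis (2 * pi * frac \<theta>))"
      unfolding indicator_def of_bool_def using g(2) g(3)[of "frac \<theta>"] by presburger
    ultimately show "indicator {\<alpha>..\<beta>} (frac \<theta>) \<le> p \<theta>" by (rule order_trans[rotated])
  next
    show "p integrable_on {0..1}" by (rule int)
    have "integral {0..1} p \<le> integral {0..1} (\<lambda>\<theta>. g (cis (2 * pi * \<theta>)) + 2 * \<epsilon> / 3)"
    proof (rule integral_le[OF int])
      show "(\<lambda>\<theta>. g (cis (2 * pi * \<theta>)) + 2 * \<epsilon> / 3) integrable_on {0..1}"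
        by (rule integrable_add[OF intg integrable_const_ivl])
      show "p \<theta> \<le> g (cis (2 * pi * \<theta>)) + 2 * \<epsilon> / 3" for \<theta>
        using gq[of "2 * pi * \<theta>"] unfolding p_def by linarith
    qed
    also have "\<dots> = integral {0..1} (\<lambda>\<theta>. g (cis (2 * pi * \<theta>))) + 2 * \<epsilon> / 3"
      using intg by (subst integral_add) auto
    finally show "integral {0..1} p \<le> \<beta> - \<alpha> + \<epsilon>" using g(4) by simp
  qed
qed

section \<open>A weighted Weyl criterion\<close>

text \<open>
  The hypothesis on positive frequencies covers negative ones by complex conjugation, and frequency 0
  gives the total weight.
\<close>
lemma trig_poly_mean:
  fixes A :: "'a \<Rightarrow> 'b set" and w x :: "'a \<Rightarrow> 'b \<Rightarrow> real" and F :: "'a filter"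
  assumes nonneg: "\<And>t. (\<Sum>i\<in>A t. w t i) \<ge> 0"
    and weyl: "\<And>k e. k \<ge> (1::nat) \<Longrightarrow> e > 0 \<Longrightarrow>
      eventually (\<lambda>t. norm (\<Sum>i\<in>A t. of_real (w t i) * cis (2 * pi * real k * x t i)) \<le> e * (\<Sum>i\<in>A t. w t i)) F"
    and p: "trig_poly p"
  shows "\<exists>I. (p has_integral I) {0..1} \<and> (\<forall>e>0. eventually (\<lambda>t.
      norm ((\<Sum>i\<in>A t. of_real (w t i) * p (x t i)) - I * of_real (\<Sum>i\<in>A t. w t i)) \<le> e * (\<Sum>i\<in>A t. w t i)) F)"
  using p
proof induction
  case (monomial c k)
  show ?case
  proof (cases "k = 0")
    case True
    have "((\<lambda>\<theta>::real. c) has_integral c) {0..1}"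
      using has_integral_const_real[of c 0 1] by simp
    moreover have "(\<Sum>i\<in>A t. of_real (w t i) * c) = c * of_real (\<Sum>i\<in>A t. w t i)" for t
      by (simp add: sum_distrib_left mult.commute)
    ultimately show ?thesis using True nonneg by (intro exI[of _ c]) auto
  next
    case False
    define m where "m = nat \<bar>k\<bar>"
    have m: "m \<ge> 1" using False by (simp add: m_def)
    have norm_eq: "norm (\<Sum>i\<in>A t. of_real (w t i) * (c * cis (2 * pi * of_int k * x t i))) =
        norm c * norm (\<Sum>i\<in>A t. of_real (w t i) * cis (2 * pi * real m * x t i))" for t
    proof -
      have "(\<Sum>i\<in>A t. of_real (w t i) * (c * cis (2 * pi * of_int k * x t i))) =
          c * (\<Sum>i\<in>A t. of_real (w t i) * cis (2 * pi * of_int k * x t i))"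
        by (simp add: sum_distrib_left mult_ac)
      moreover have "norm (\<Sum>i\<in>A t. of_real (w t i) * cis (2 * pi * of_int k * x t i)) =
          norm (\<Sum>i\<in>A t. of_real (w t i) * cis (2 * pi * real m * x t i))"
      proof (cases "k \<ge> 0")
        case True
        then have "of_int k = real m" by (simp add: m_def)
        then show ?thesis by simp
      next
        case False
        then have k: "of_int k = - real m" by (simp add: m_def)
        have "(\<Sum>i\<in>A t. of_real (w t i) * cis (2 * pi * of_int k * x t i)) =
            cnj (\<Sum>i\<in>A t. of_real (w t i) * cis (2 * pi * real m * x t i))"
          unfolding k by (simp add: cis_cnj)
        then show ?thesis by (simp only: complex_mod_cnj)
      qed
      ultimately show ?thesis by (simp add: norm_mult)
    qed
    show ?thesis
    proof (intro exI[of _ 0] conjI allI impI)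
      show "((\<lambda>\<theta>. c * cis (2 * pi * of_int k * \<theta>)) has_integral 0) {0..1}"
        by (rule cis_has_integral_0[OF False])
      fix e :: real assume e: "e > 0"
      define d where "d = e / (norm c + 1)"
      have c1: "norm c + 1 > 0" using norm_ge_zero[of c] by linarith
      have d: "d > 0" "norm c * d \<le> e"
        using e c1 by (auto simp: d_def field_simps)
      from weyl[OF m d(1)]
      show "eventually (\<lambda>t. norm ((\<Sum>i\<in>A t. of_real (w t i) * (c * cis (2 * pi * of_int k * x t i))) -
          0 * of_real (\<Sum>i\<in>A t. w t i)) \<le> e * (\<Sum>i\<in>A t. w t i)) F"
      proof eventually_elim
        case (elim t)
        have "norm c * norm (\<Sum>i\<in>A t. of_real (w t i) * cis (2 * pi * real m * x t i)) \<le> norm c * (d * (\<Sum>i\<in>A t. w t i))"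
          using elim by (intro mult_left_mono) auto
        also have "\<dots> \<le> e * (\<Sum>i\<in>A t. w t i)"
          unfolding mult.assoc[symmetric] using d(2) nonneg by (intro mult_right_mono)
        finally show ?case by (simp add: norm_eq)
      qed
    qed
  qed
next
  case (add p q)
  then obtain I J where I: "(p has_integral I) {0..1}" "\<And>e. e > 0 \<Longrightarrow> eventually (\<lambda>t.
      norm ((\<Sum>i\<in>A t. of_real (w t i) * p (x t i)) - I * of_real (\<Sum>i\<in>A t. w t i)) \<le> e * (\<Sum>i\<in>A t. w t i)) F"
    and J: "(q has_integral J) {0..1}" "\<And>e. e > 0 \<Longrightarrow> eventually (\<lambda>t.
      norm ((\<Sum>i\<in>A t. of_real (w t i) * q (x t i)) - J * of_real (\<Sum>i\<in>A t. w t i)) \<le> e * (\<Sum>i\<in>A t. w t i)) F"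
    by blast
  show ?case
  proof (intro exI[of _ "I + J"] conjI allI impI)
    show "((\<lambda>\<theta>. p \<theta> + q \<theta>) has_integral (I + J)) {0..1}"
      by (intro has_integral_add I J)
    fix e :: real assume "e > 0"
    then have e: "e / 2 > 0" by simp
    from I(2)[OF e] J(2)[OF e]
    show "eventually (\<lambda>t. norm ((\<Sum>i\<in>A t. of_real (w t i) * (p (x t i) + q (x t i))) -
        (I + J) * of_real (\<Sum>i\<in>A t. w t i)) \<le> e * (\<Sum>i\<in>A t. w t i)) F"
    proof eventually_elim
      case (elim t)
      let ?P = "(\<Sum>i\<in>A t. of_real (w t i) * p (x t i)) - I * of_real (\<Sum>i\<in>A t. w t i)"
      let ?Q = "(\<Sum>i\<in>A t. of_real (w t i) * q (x t i)) - J * of_real (\<Sum>i\<in>A t. w t i)"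
      have "(\<Sum>i\<in>A t. of_real (w t i) * (p (x t i) + q (x t i))) - (I + J) * of_real (\<Sum>i\<in>A t. w t i) = ?P + ?Q"
        by (simp only: distrib_left distrib_right sum.distrib) (simp add: algebra_simps)
      moreover have "norm (?P + ?Q) \<le> e / 2 * (\<Sum>i\<in>A t. w t i) + e / 2 * (\<Sum>i\<in>A t. w t i)"
        using elim by (rule norm_triangle_mono)
      moreover have "e / 2 * (\<Sum>i\<in>A t. w t i) + e / 2 * (\<Sum>i\<in>A t. w t i) = e * (\<Sum>i\<in>A t. w t i)"
        by (simp add: field_simps)
      ultimately show ?case by metis
    qed
  qed
qed

text \<open>
  Up to an arbitrarily small proportion, the weighted sum of a trigonometric majorant is its
  integral times the total weight.
\<close>
lemma weyl_upper_bound: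
  fixes A :: "'a \<Rightarrow> 'b set" and w x :: "'a \<Rightarrow> 'b \<Rightarrow> real" and F :: "'a filter"
  assumes w: "\<And>t i. w t i \<ge> 0"
    and weyl: "\<And>k e. k \<ge> (1::nat) \<Longrightarrow> e > 0 \<Longrightarrow>
      eventually (\<lambda>t. norm (\<Sum>i\<in>A t. of_real (w t i) * cis (2 * pi * real k * x t i)) \<le> e * (\<Sum>i\<in>A t. w t i)) F"
    and ab: "0 \<le> \<alpha>" "\<alpha> \<le> \<beta>" "\<beta> \<le> 1" and e: "\<epsilon> > 0"
  shows "eventually (\<lambda>t. (\<Sum>i\<in>A t. w t i * indicator {\<alpha>..\<beta>} (frac (x t i))) \<le> (\<beta> - \<alpha> + \<epsilon>) * (\<Sum>i\<in>A t. w t i)) F"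
proof -
  have e2: "\<epsilon> / 2 > 0" using e by simp
  obtain p where p: "trig_poly (\<lambda>\<theta>. of_real (p \<theta>))"
    "\<And>\<theta>. indicator {\<alpha>..\<beta>} (frac \<theta>) \<le> p \<theta>"
    "p integrable_on {0..1}" "integral {0..1} p \<le> \<beta> - \<alpha> + \<epsilon> / 2"
    using arc_trig_poly_majorant[OF ab e2] by metis
  have nonneg: "(\<Sum>i\<in>A t. w t i) \<ge> 0" for t using w by (intro sum_nonneg) auto
  obtain I where I: "((\<lambda>\<theta>. complex_of_real (p \<theta>)) has_integral I) {0..1}" "\<And>e. e > 0 \<Longrightarrow> eventually (\<lambda>t.
      norm ((\<Sum>i\<in>A t. of_real (w t i) * complex_of_real (p (x t i))) - I * of_real (\<Sum>i\<in>A t. w t i)) \<le> e * (\<Sum>i\<in>A t. w t i)) F"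
    using trig_poly_mean[OF nonneg weyl p(1)] by blast
  have "((\<lambda>\<theta>. complex_of_real (p \<theta>)) has_integral of_real (integral {0..1} p)) {0..1}"
    using p(3) by (intro has_integral_of_real integrable_integral)
  then have Ieq: "I = of_real (integral {0..1} p)" using I(1) has_integral_unique by blast
  from I(2)[OF e2] show ?thesis
  proof eventually_elim
    case (elim t)
    have "(\<Sum>i\<in>A t. of_real (w t i) * complex_of_real (p (x t i))) - I * of_real (\<Sum>i\<in>A t. w t i)
        = of_real ((\<Sum>i\<in>A t. w t i * p (x t i)) - integral {0..1} p * (\<Sum>i\<in>A t. w t i))"
      by (simp add: Ieq)
    then have "\<bar>(\<Sum>i\<in>A t. w t i * p (x t i)) - integral {0..1} p * (\<Sum>i\<in>A t. w t i)\<bar> \<le> \<epsilon> / 2 * (\<Sum>i\<in>A t. w t i)"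
      using elim by (simp only: norm_of_real)
    moreover have "(\<Sum>i\<in>A t. w t i * indicator {\<alpha>..\<beta>} (frac (x t i))) \<le> (\<Sum>i\<in>A t. w t i * p (x t i))"
      using p(2) w by (intro sum_mono mult_left_mono)
    moreover have "integral {0..1} p * (\<Sum>i\<in>A t. w t i) \<le> (\<beta> - \<alpha> + \<epsilon> / 2) * (\<Sum>i\<in>A t. w t i)"
      using p(4) nonneg by (rule mult_right_mono)
    moreover have "(\<beta> - \<alpha> + \<epsilon> / 2) * (\<Sum>i\<in>A t. w t i) + \<epsilon> / 2 * (\<Sum>i\<in>A t. w t i) = (\<beta> - \<alpha> + \<epsilon>) * (\<Sum>i\<in>A t. w t i)"
      by (simp add: field_simps)
    ultimately show ?case by linarith
  qed
qed

text \<open>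
  For uniformity in the interval, intervals are enlarged to have endpoints in a fixed finite grid. This
  loses two mesh lengths in the upper bound. The lower bound follows by applying the upper bound to the two complementary
  intervals; counting the endpoints twice does no harm in this direction.
\<close>
lemma weyl_criterion:
  fixes A :: "'a \<Rightarrow> 'b set" and w x :: "'a \<Rightarrow> 'b \<Rightarrow> real" and F :: "'a filter"
  assumes w: "\<And>t i. w t i \<ge> 0"
    and weyl: "\<And>k e. k \<ge> (1::nat) \<Longrightarrow> e > 0 \<Longrightarrow>
      eventually (\<lambda>t. norm (\<Sum>i\<in>A t. of_real (w t i) * cis (2 * pi * real k * x t i)) \<le> e * (\<Sum>i\<in>A t. w t i)) F"
    and e: "\<epsilon> > 0"
  shows "eventually (\<lambda>t. \<forall>\<alpha> \<beta>. 0 \<le> \<alpha> \<longrightarrow> \<alpha> \<le> \<beta> \<longrightarrow> \<beta> \<le> 1 \<longrightarrow>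
     \<bar>(\<Sum>i\<in>A t. w t i * indicator {\<alpha>..\<beta>} (frac (x t i))) - (\<beta> - \<alpha>) * (\<Sum>i\<in>A t. w t i)\<bar> \<le> \<epsilon> * (\<Sum>i\<in>A t. w t i)) F"
proof -
  define S where "S = (\<lambda>t \<alpha> \<beta>. \<Sum>i\<in>A t. w t i * indicator {\<alpha>..\<beta>} (frac (x t i)))"
  define N where "N = (\<lambda>t. \<Sum>i\<in>A t. w t i)"
  have N0: "N t \<ge> 0" for t unfolding N_def using w by (intro sum_nonneg) auto
  define d where "d = \<epsilon> / 6"
  have d: "d > 0" using e by (simp add: d_def)
  obtain K :: nat where K: "K > 0" "1 / real K < d"
    using reals_Archimedean[OF d] by (auto simp: inverse_eq_divide intro: that[of "Suc _"])
  have "eventually (\<lambda>t. \<forall>i\<in>{..K}. \<forall>j\<in>{..K}. i \<le> j \<longrightarrow> S t (real i / K) (real j / K) \<le> (real j / K - real i / K + d) * N t) F"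
  proof (intro eventually_ball_finite finite_atMost ballI)
    fix i j assume "i \<in> {..K}" "j \<in> {..K}"
    show "eventually (\<lambda>t. i \<le> j \<longrightarrow> S t (real i / K) (real j / K) \<le> (real j / K - real i / K + d) * N t) F"
    proof (cases "i \<le> j")
      case True
      then show ?thesis
        using weyl_upper_bound[where A = A and w = w and x = x, OF w weyl, of "real i / K" "real j / K" d] d K(1) \<open>j \<in> {..K}\<close>
        by (simp add: S_def N_def divide_right_mono)
    qed simp
  qed
  then show ?thesis
  proof eventually_elim
    case (elim t)
    have mono: "S t a b \<le> S t a' b'" if "a' \<le> a" "b \<le> b'" for a b a' b'
      unfolding S_def using w that by (intro sum_mono mult_left_mono) (auto simp: indicator_def)
    have upper: "S t \<alpha> \<beta> \<le> (\<beta> - \<alpha> + 3 * d) * N t" if ab: "0 \<le> \<alpha>" "\<alpha> \<le> \<beta>" "\<beta> \<le> 1" for \<alpha> \<beta>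
    proof -
      define i where "i = nat \<lfloor>\<alpha> * K\<rfloor>"
      define j where "j = nat \<lceil>\<beta> * K\<rceil>"
      have aK: "0 \<le> \<alpha> * K" "\<alpha> * K \<le> \<beta> * K" "\<beta> * K \<le> K"
        using ab by (auto intro: mult_right_mono mult_left_le_one_le)
      have i: "real i \<le> \<alpha> * K" "\<alpha> * K < real i + 1"
        using aK by (auto simp: i_def)
      have j: "\<beta> * K \<le> real j" "real j < \<beta> * K + 1"
        using aK by (auto simp: j_def) linarith+
      have "j \<le> K" using aK(3) by (simp add: j_def ceiling_le_iff)
      moreover have "i \<le> j" using i j aK by linarith
      ultimately have "S t (real i / K) (real j / K) \<le> (real j / K - real i / K + d) * N t"
        using elim by simp
      moreover have "S t \<alpha> \<beta> \<le> S t (real i / K) (real j / K)"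
        using i j K(1) by (intro mono) (simp_all add: field_simps)
      moreover have "real j / K \<le> (\<beta> * K + 1) / K" "\<alpha> \<le> (real i + 1) / K"
        using i j K(1) by (auto simp: pos_le_divide_eq intro!: divide_right_mono)
      then have "real j / K \<le> \<beta> + 1 / K" "\<alpha> \<le> real i / K + 1 / K"
        using K(1) by (simp_all add: add_divide_distrib)
      then have "(real j / K - real i / K + d) * N t \<le> (\<beta> - \<alpha> + 3 * d) * N t"
        using K(2) N0 by (intro mult_right_mono) auto
      ultimately show ?thesis by linarith
    qed
    show ?case
    proof (intro allI impI)
      fix \<alpha> \<beta> :: real assume ab: "0 \<le> \<alpha>" "\<alpha> \<le> \<beta>" "\<beta> \<le> 1"
      have "N t \<le> S t 0 \<alpha> + S t \<alpha> \<beta> + S t \<beta> 1"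
        unfolding N_def S_def sum.distrib[symmetric]
      proof (rule sum_mono)
        fix i
        have f: "0 \<le> frac (x t i)" "frac (x t i) \<le> 1" using frac_lt_1[of "x t i"] by auto
        have "1 \<le> (indicator {0..\<alpha>} (frac (x t i)) + indicator {\<alpha>..\<beta>} (frac (x t i)) + indicator {\<beta>..1} (frac (x t i)) :: real)"
          using f by (auto simp: indicator_def)
        from mult_left_mono[OF this w[of t i]]
        show "w t i \<le> w t i * indicator {0..\<alpha>} (frac (x t i)) + w t i * indicator {\<alpha>..\<beta>} (frac (x t i)) + w t i * indicator {\<beta>..1} (frac (x t i))"
          by (simp add: distrib_left)
      qed
      moreover have "S t 0 \<alpha> \<le> (\<alpha> + 3 * d) * N t" using upper[of 0 \<alpha>] ab by simp
      moreover have "S t \<beta> 1 \<le> (1 - \<beta> + 3 * d) * N t" using upper[of \<beta> 1] ab by simp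
      moreover have "S t \<alpha> \<beta> \<le> (\<beta> - \<alpha> + 3 * d) * N t" using upper ab by simp
      moreover have "d * N t \<ge> 0" using d N0 by simp
      ultimately have "\<bar>S t \<alpha> \<beta> - (\<beta> - \<alpha>) * N t\<bar> \<le> 6 * (d * N t)"
        by (simp add: algebra_simps abs_le_iff)
      also have "\<dots> = \<epsilon> * N t" by (simp add: d_def)
      finally show "\<bar>(\<Sum>i\<in>A t. w t i * indicator {\<alpha>..\<beta>} (frac (x t i))) - (\<beta> - \<alpha>) * (\<Sum>i\<in>A t. w t i)\<bar> \<le> \<epsilon> * (\<Sum>i\<in>A t. w t i)"
        by (simp add: S_def N_def)
    qed
  qed
qed

section \<open>Equidistribution of the ordinates\<close>

lemma zero_exp_sum_power:
  assumes "T > 0"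
  shows "zero_exp_sum (T ^ k) T =
    (\<Sum>\<gamma> | \<gamma> \<in> zeta_ordinates \<and> 0 < \<gamma> \<and> \<gamma> \<le> T.
       of_real (real (ordinate_mult \<gamma>)) * cis (2 * pi * real k * (\<gamma> * ln T / (2 * pi))))"
  unfolding zero_exp_sum_def
proof (intro sum.cong refl)
  fix \<gamma>
  have "complex_of_real (T ^ k) powr (\<i> * complex_of_real \<gamma>) = exp (\<i> * of_real \<gamma> * of_real (ln (T ^ k)))"
    using assms by (simp add: powr_def Ln_of_real[symmetric] del: of_real_power)
  also have "\<dots> = cis (2 * pi * real k * (\<gamma> * ln T / (2 * pi)))"
    using assms by (simp add: cis_conv_exp ln_realpow mult_ac)
  finally show "of_nat (ordinate_mult \<gamma>) * complex_of_real (T ^ k) powr (\<i> * complex_of_real \<gamma>) =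
      of_real (real (ordinate_mult \<gamma>)) * cis (2 * pi * real k * (\<gamma> * ln T / (2 * pi)))"
    by simp
qed

text \<open>
  With \<open>\<epsilon> = 1/(20 k)\<close> both terms of the conjectured bound at \<open>x = T^k\<close> are at most \<open>T^(11/20)\<close>, which is of
  smaller order than the lower bound \<open>T^(3/5) / 4\<close> for the number of ordinates.
\<close>
lemma zero_exp_sum_power_small:
  assumes RH: riemann_hypothesis and conj: zero_exp_sum_conjecture
    and k: "k \<ge> (1::nat)" and e: "e > 0"
  shows "eventually (\<lambda>T. norm (zero_exp_sum (T ^ k) T) \<le> e * zero_count T) at_top"
proof -
  define \<epsilon> where "\<epsilon> = 1 / (20 * real k)"
  have "\<epsilon> > 0" using k by (simp add: \<epsilon>_def)
  then obtain C where C: "\<And>x T. x \<ge> 2 \<Longrightarrow> T \<ge> 2 \<Longrightarrow> norm (zero_exp_sum x T) \<le>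
        C * (T * x powr (- (1 / 2) + \<epsilon>) + T powr (1 / 2) * x powr \<epsilon>)"
    using conj unfolding zero_exp_sum_conjecture_def by blast
  define D where "D = max C 1"
  have D: "D > 0" by (simp add: D_def)
  have "eventually (\<lambda>T::real. D * (2 * T powr (11/20)) \<le> e * (T powr (3/5) / 4)) at_top"
    using D e by real_asymp
  moreover have "eventually (\<lambda>T::real. T \<ge> 2) at_top" by (rule eventually_ge_at_top)
  moreover note zero_count_lower_bound[OF RH]
  ultimately show ?thesis
  proof eventually_elim
    case (elim T)
    have T: "T \<ge> 2" using elim by simp
    have x: "T ^ k \<ge> 2" using T k self_le_power[of T k] by simp
    have pw: "(T ^ k) powr a = T powr (real k * a)" for a
      using T by (simp add: powr_powr flip: powr_realpow)
    have "T * (T ^ k) powr (- (1 / 2) + \<epsilon>) = T powr (1 + (real k * (- (1 / 2) + \<epsilon>)))"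
      unfolding pw powr_add[of T 1] using T by simp
    also have "\<dots> \<le> T powr (11/20)"
    proof (rule powr_mono)
      have "real k * (- (1 / 2) + \<epsilon>) = - real k / 2 + 1 / 20"
        using k by (simp add: \<epsilon>_def field_simps)
      then show "1 + (real k * (- (1 / 2) + \<epsilon>)) \<le> 11/20" using k by simp
    qed (use T in simp)
    finally have 1: "T * (T ^ k) powr (- (1 / 2) + \<epsilon>) \<le> T powr (11/20)" .
    have "real k * \<epsilon> = 1 / 20" using k by (simp add: \<epsilon>_def)
    then have "T powr (1 / 2) * (T ^ k) powr \<epsilon> = T powr (1/2) * T powr (1/20)" by (simp only: pw)
    also have "\<dots> = T powr (11/20)" by (simp flip: powr_add)
    finally have 2: "T powr (1 / 2) * (T ^ k) powr \<epsilon> = T powr (11/20)" .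
    have "norm (zero_exp_sum (T ^ k) T) \<le> C * (T * (T ^ k) powr (- (1 / 2) + \<epsilon>) + T powr (1 / 2) * (T ^ k) powr \<epsilon>)"
      by (rule C[OF x T])
    also have "\<dots> \<le> D * (T * (T ^ k) powr (- (1 / 2) + \<epsilon>) + T powr (1 / 2) * (T ^ k) powr \<epsilon>)"
      using T by (intro mult_right_mono) (auto simp: D_def)
    also have "\<dots> \<le> D * (2 * T powr (11/20))"
      using 1 2 D by (intro mult_left_mono) auto
    also have "\<dots> \<le> e * (T powr (3/5) / 4)" using elim by blast
    also have "\<dots> \<le> e * zero_count T" using elim e by (intro mult_left_mono) auto
    finally show ?case .
  qed
qed

theorem theorem1p3:
  assumes "riemann_hypothesis"
    and "zero_exp_sum_conjecture"
  shows "(\<lambda>T::real. SUP (\<alpha>, \<beta>) \<in> {(\<alpha>::real, \<beta>::real). 0 \<le> \<alpha> \<and> \<alpha> \<le> \<beta> \<and> \<beta> \<le> 1}.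
            \<bar>frac_zero_count T \<alpha> \<beta> - (\<beta> - \<alpha>) * zero_count T\<bar>)
         \<in> o[at_top](zero_count)"
proof (rule landau_o.smallI)
  fix c :: real assume c: "c > 0"
  define A where "A = (\<lambda>T. {\<gamma>. \<gamma> \<in> zeta_ordinates \<and> 0 < \<gamma> \<and> \<gamma> \<le> T})"
  define w where "w = (\<lambda>(T::real) \<gamma>. real (ordinate_mult \<gamma>))"
  define x where "x = (\<lambda>T \<gamma>. \<gamma> * ln T / (2 * pi))"
  have N: "(\<Sum>\<gamma>\<in>A T. w T \<gamma>) = zero_count T" for T
    by (simp add: A_def w_def zero_count_def)
  have frac_count: "(\<Sum>\<gamma>\<in>A T. w T \<gamma> * indicator {\<alpha>..\<beta>} (frac (x T \<gamma>))) = frac_zero_count T \<alpha> \<beta>" for T \<alpha> \<beta>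
  proof -
    have "(\<Sum>\<gamma>\<in>A T. w T \<gamma> * indicator {\<alpha>..\<beta>} (frac (x T \<gamma>))) =
        (\<Sum>\<gamma>\<in>A T. if frac (x T \<gamma>) \<in> {\<alpha>..\<beta>} then w T \<gamma> else 0)"
      by (intro sum.cong refl) (simp add: indicator_def)
    also have "\<dots> = (\<Sum>\<gamma>\<in>{\<gamma> \<in> A T. frac (x T \<gamma>) \<in> {\<alpha>..\<beta>}}. w T \<gamma>)"
      using finite_ordinates[of T] by (intro sum.inter_filter[symmetric]) (simp add: A_def)
    also have "{\<gamma> \<in> A T. frac (x T \<gamma>) \<in> {\<alpha>..\<beta>}} =
        {\<gamma>. \<gamma> \<in> zeta_ordinates \<and> 0 < \<gamma> \<and> \<gamma> \<le> T \<and> frac (\<gamma> * ln T / (2 * pi)) \<in> {\<alpha>..\<beta>}}"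
      by (simp only: A_def x_def) blast
    finally show ?thesis by (simp add: frac_zero_count_def w_def)
  qed
  have "eventually (\<lambda>T. norm (\<Sum>\<gamma>\<in>A T. of_real (w T \<gamma>) * cis (2 * pi * real k * x T \<gamma>)) \<le> e * (\<Sum>\<gamma>\<in>A T. w T \<gamma>)) at_top"
    if "k \<ge> 1" "e > 0" for k :: nat and e :: real
    using zero_exp_sum_power_small[OF assms that] eventually_gt_at_top[of 0]
    by eventually_elim (unfold N, simp only: zero_exp_sum_power A_def w_def x_def)
  from weyl_criterion[where A = A and w = w and x = x, OF _ this c]
  have "eventually (\<lambda>T. \<forall>\<alpha> \<beta>. 0 \<le> \<alpha> \<longrightarrow> \<alpha> \<le> \<beta> \<longrightarrow> \<beta> \<le> 1 \<longrightarrow>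
     \<bar>frac_zero_count T \<alpha> \<beta> - (\<beta> - \<alpha>) * zero_count T\<bar> \<le> c * zero_count T) at_top"
    unfolding N frac_count by (simp add: w_def)
  then show "eventually (\<lambda>T. norm (SUP (\<alpha>, \<beta>) \<in> {(\<alpha>::real, \<beta>::real). 0 \<le> \<alpha> \<and> \<alpha> \<le> \<beta> \<and> \<beta> \<le> 1}.
            \<bar>frac_zero_count T \<alpha> \<beta> - (\<beta> - \<alpha>) * zero_count T\<bar>) \<le> c * norm (zero_count T)) at_top"
  proof eventually_elim
    case (elim T)
    define I where "I = {(\<alpha>::real, \<beta>::real). 0 \<le> \<alpha> \<and> \<alpha> \<le> \<beta> \<and> \<beta> \<le> 1}"
    define f where "f = (\<lambda>(\<alpha>, \<beta>). \<bar>frac_zero_count T \<alpha> \<beta> - (\<beta> - \<alpha>) * zero_count T\<bar>)"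
    have le: "f p \<le> c * zero_count T" if "p \<in> I" for p
      using elim that by (auto simp: f_def I_def)
    have mem: "(0, 0) \<in> I" by (simp add: I_def)
    have "zero_count T \<ge> 0" by (simp add: zero_count_def sum_nonneg)
    moreover have "(SUP p\<in>I. f p) \<le> c * zero_count T"
      using mem le by (intro cSUP_least) auto
    moreover have "f (0, 0) \<le> (SUP p\<in>I. f p)"
      using mem le by (intro cSUP_upper bdd_aboveI2) auto
    moreover have "f (0, 0) \<ge> 0" by (simp add: f_def)
    ultimately have "norm (SUP p\<in>I. f p) \<le> c * norm (zero_count T)" by simp
    then show ?case by (simp only: I_def f_def)
  qed
qed

end
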